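(* Let $G$ be a graph (loops and multiple edges allowed). Then $G^{[1]}$ can be realised as an infinitesimally rigid linearly-constrained framework in $\mathbb{R}^3$ if and only if $G$ has a $(2,0)$-tight looped simple spanning subgraph which contains no copy of $K_5$.
   Context: A graph $G=(V,E,L)$ is finite and may contain multiple edges and loops; $V$, $E$, $L$ are its sets of vertices, (non-loop) edges and loops. A looped simple graph is a graph with no multiple (parallel non-loop) edges, but which may contain loops, possibly several at the same vertex. A spanning subgraph of $G$ is a subgraph with vertex set $V$. A graph contains a copy of $K_5$ if it has a subgraph isomorphic to the complete simple graph $K_5$. For $F\subseteq E\cup L$, $V_F$ denotes the set of vertices incident to $F$. $G$ is $(2,0)$-sparse if $|F|\le 2|V_F|$ for all $\emptyset\ne F\subseteq E\cup L$; it is $(2,0)$-tight if it is $(2,0)$-sparse and $|E|+|L|=2|V|$. $G^{[1]}$ denotes the graph obtained from $G$ by adding one (new) loop at each vertex of $G$. A linearly-constrained framework in $\mathbb{R}^d$ is a triple $(G,p,q)$ where $G=(V,E,L)$ is a graph, $p:V\to\mathbb{R}^d$ and $q:L\to\mathbb{R}^d$; it is also called a realisation of $G$ in $\mathbb{R}^d$. An infinitesimal motion of $(G,p,q)$ is a map $\dot p:V\to\mathbb{R}^d$ such that $(p(u)-p(v))\cdot(\dot p(u)-\dot p(v))=0$ for every edge $uv\in E$, and $q(e)\cdot\dot p(v)=0$ for every loop $e\in L$ incident to the vertex $v$. The framework is infinitesimally rigid if its only infinitesimal motion is $\dot p=0$. "A graph can be realised as an infinitesimally rigid linearly-constrained framework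 in $\mathbb{R}^d$" means that there exist $p,q$ such that $(G,p,q)$ is infinitesimally rigid. *)

theory Defs
  imports "HOL-Analysis.Analysis"
begin

text \<open>
  Edges and loops are named objects of one type, so parallel edges and several loops at
  a vertex are possible. An edge has two distinct end vertices and a loop has one; in
  particular the sets of edges and loops of a graph are disjoint.
\<close>

record ('v, 'e) graph =
  verts :: "'v set"
  edges :: "'e set"
  loops :: "'e set"
  ends :: "'e \<Rightarrow> 'v set"

definition is_graph :: "('v, 'e) graph \<Rightarrow> bool" where
  "is_graph G \<longleftrightarrow>
     finite (verts G) \<and> finite (edges G) \<and> finite (loops G) \<and>
     (\<forall>e\<in>edges G. ends G e \<subseteq> verts G \<and> card (ends G e) = 2) \<and>
     (\<forall>l\<in>loops G. ends G l \<subseteq> verts G \<and> card (ends G l) = 1)"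

definition looped_simple :: "('v, 'e) graph \<Rightarrow> bool" where
  "looped_simple G \<longleftrightarrow> is_graph G \<and> inj_on (ends G) (edges G)"

definition subgraph :: "('v, 'e) graph \<Rightarrow> ('v, 'e) graph \<Rightarrow> bool" where
  "subgraph H G \<longleftrightarrow>
     is_graph H \<and> verts H \<subseteq> verts G \<and> edges H \<subseteq> edges G \<and> loops H \<subseteq> loops G \<and>
     (\<forall>e\<in>edges H \<union> loops H. ends H e = ends G e)"

definition spanning_subgraph :: "('v, 'e) graph \<Rightarrow> ('v, 'e) graph \<Rightarrow> bool" where
  "spanning_subgraph H G \<longleftrightarrow> subgraph H G \<and> verts H = verts G"

definition isomorphic :: "('v, 'e) graph \<Rightarrow> ('w, 'f) graph \<Rightarrow> bool" where
  "isomorphic G H \<longleftrightarrow>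
     (\<exists>f g. bij_betw f (verts G) (verts H) \<and>
            bij_betw g (edges G) (edges H) \<and> bij_betw g (loops G) (loops H) \<and>
            (\<forall>e\<in>edges G \<union> loops G. ends H (g e) = f ` ends G e))"

definition complete_graph :: "nat \<Rightarrow> (nat, nat set) graph" where
  "complete_graph n =
     \<lparr>verts = {..<n}, edges = {e. e \<subseteq> {..<n} \<and> card e = 2}, loops = {}, ends = id\<rparr>"

definition contains_copy :: "('v, 'e) graph \<Rightarrow> ('w, 'f) graph \<Rightarrow> bool" where
  "contains_copy G K \<longleftrightarrow> (\<exists>H. subgraph H G \<and> isomorphic H K)"

definition incident_verts :: "('v, 'e) graph \<Rightarrow> 'e set \<Rightarrow> 'v set" where
  "incident_verts G F = (\<Union>e\<in>F. ends G e)"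

definition sparse_2_0 :: "('v, 'e) graph \<Rightarrow> bool" where
  "sparse_2_0 G \<longleftrightarrow>
     (\<forall>F. F \<noteq> {} \<and> F \<subseteq> edges G \<union> loops G \<longrightarrow> card F \<le> 2 * card (incident_verts G F))"

definition tight_2_0 :: "('v, 'e) graph \<Rightarrow> bool" where
  "tight_2_0 G \<longleftrightarrow>
     sparse_2_0 G \<and> card (edges G) + card (loops G) = 2 * card (verts G)"

text \<open>The new loop at a vertex v is named \<open>Inr v\<close>; the old edges and loops are tagged by \<open>Inl\<close>.\<close>

definition add_loop_everywhere :: "('v, 'e) graph \<Rightarrow> ('v, 'e + 'v) graph" where
  "add_loop_everywhere G =
     \<lparr>verts = verts G, edges = Inl ` edges G, loops = Inl ` loops G \<union> Inr ` verts G,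
      ends = case_sum (ends G) (\<lambda>v. {v})\<rparr>"

text \<open>
  The maps p, q and m below are total functions; only the values of p and m on
  vertices and of q on loops are relevant.
\<close>

definition infinitesimal_motion ::
  "('v, 'e) graph \<Rightarrow> ('v \<Rightarrow> real ^ 'd) \<Rightarrow> ('e \<Rightarrow> real ^ 'd) \<Rightarrow> ('v \<Rightarrow> real ^ 'd) \<Rightarrow> bool" where
  "infinitesimal_motion G p q m \<longleftrightarrow>
     (\<forall>e\<in>edges G. \<forall>u v. ends G e = {u, v} \<longrightarrow> (p u - p v) \<bullet> (m u - m v) = 0) \<and>
     (\<forall>l\<in>loops G. \<forall>v. ends G l = {v} \<longrightarrow> q l \<bullet> m v = 0)"

definition infinitesimally_rigid ::
  "('v, 'e) graph \<Rightarrow> ('v \<Rightarrow> real ^ 'd) \<Rightarrow> ('e \<Rightarrow> real ^ 'd) \<Rightarrow> bool" where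
  "infinitesimally_rigid G p q \<longleftrightarrow>
     (\<forall>m. infinitesimal_motion G p q m \<longrightarrow> (\<forall>v\<in>verts G. m v = 0))"

lemma is_graph_complete_graph: "is_graph (complete_graph n)"
  by (auto simp: is_graph_def complete_graph_def)

lemma is_graph_add_loop_everywhere: "is_graph G \<Longrightarrow> is_graph (add_loop_everywhere G)"
  by (simp add: is_graph_def add_loop_everywhere_def ball_Un)

end

theory Submission
  imports Defs
begin

text \<open>
  Velocities \<open>m\<close> of a framework are confined by the additional loop at each vertex to a plane, so
  \<open>2 |V|\<close> further constraints are needed.

  Necessity. Among the edges and loops of \<open>G\<close> choose a minimal set \<open>F\<close> that, together with the
  additional loops, forces all velocities to vanish. By minimality each \<open>f \<in> F\<close> has a dual motion, which
  satisfies all constraints except that of \<open>f\<close>. Counting unknowns gives \<open>|F| \<ge> 2 |V|\<close>. The dual motions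
  of a subset \<open>F'\<close> stay independent when restricted to the vertices incident to \<open>F'\<close>, which gives
  sparsity. Parallel edges and copies of \<open>K\<^sub>5\<close> have dependent rows: five points in space satisfy
  an affine dependence \<open>\<omega>\<close>, and \<open>\<omega> u * \<omega> v\<close> is a stress (\<open>affine_dependence_stress\<close>).

  Sufficiency. Induct on the number of vertices. In a nonempty tight graph there is a vertex \<open>v\<close> with two or
  three incident edges and loops, or the graph is 4-regular without loops. In each case \<open>v\<close> is removed,
  a tight \<open>K\<^sub>5\<close>-free graph is restored by adding as many constraints as tightness requires, and \<open>v\<close>
  is put back in a special position where its constraints imply the added ones:

  \<^item> For degree two, nothing is added, and \<open>v\<close> is put in general position.
  \<^item> For degree three, a loop is added at a neighbour \<open>a\<close> that lies in no set of maximal load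
    (\<open>obtain_loop_vertex\<close>); the vertex \<open>v\<close> is placed on the line through \<open>a\<close> in the direction of the normal of
    this loop (\<open>rigid_add_vertex_degree_3\<close>).
  \<^item> In the 4-regular case, \<open>v\<close> has two nonadjacent neighbours \<open>a\<close> and \<open>b\<close> such that the edge \<open>ab\<close> creates
    no \<open>K\<^sub>5\<close> (\<open>regular_nonadjacent_pair\<close>). This edge and a loop at a third neighbour \<open>c\<close> are added; the
    vertex \<open>v\<close> is placed at the intersection of the line \<open>ab\<close> with the plane through \<open>c\<close> spanned by
    the two normals at \<open>c\<close> (\<open>rigid_add_vertex_degree_4\<close>).

  Each placement needs the smaller framework to be in general position. This can be arranged
  because rigidity is preserved by small perturbations (\<open>rigid_generic\<close>).
\<close>

section \<open>Linear functionals on assignments of velocities\<close>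

definition linear_functional :: "(('v \<Rightarrow> 'a::real_vector) \<Rightarrow> real) \<Rightarrow> bool" where
  "linear_functional f \<longleftrightarrow>
     (\<forall>x y. f (\<lambda>v. x v + y v) = f x + f y) \<and> (\<forall>c x. f (\<lambda>v. c *\<^sub>R x v) = c * f x)"

lemma linear_functional_sum:
  assumes "linear_functional f" "finite I"
  shows "f (\<lambda>v. \<Sum>i\<in>I. c i *\<^sub>R x i v) = (\<Sum>i\<in>I. c i * f (x i))"
  using assms(2)
proof induction
  case empty
  have "f (\<lambda>_. 0) = 0"
    using assms(1)[unfolded linear_functional_def, THEN conjunct2, rule_format, of 0 "\<lambda>_. 0"]
    by simp
  then show ?case by simp
next
  case (insert i I)
  then show ?case using assms(1) unfolding linear_functional_def by simp
qed

lemma linear_functional_diff: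
  assumes "linear_functional f"
  shows "f (\<lambda>v. x v - y v) = f x - f y"
proof -
  have "f (\<lambda>v. x v + (\<lambda>v. (-1) *\<^sub>R y v) v) = f x + f (\<lambda>v. (-1) *\<^sub>R y v)"
    using assms unfolding linear_functional_def by fast
  moreover have "f (\<lambda>v. (-1) *\<^sub>R y v) = (-1) * f y"
    using assms unfolding linear_functional_def by fast
  ultimately show ?thesis by simp
qed

text \<open>
  Gaussian elimination on the first equation: solving it for one unknown removes one equation and
  one unknown.
\<close>

lemma underdetermined_system:
  fixes A :: "'j \<Rightarrow> 'i \<Rightarrow> real"
  assumes "finite J" "finite I" "card J < card I"
  shows "\<exists>c. (\<exists>i\<in>I. c i \<noteq> 0) \<and> (\<forall>j\<in>J. (\<Sum>i\<in>I. A j i * c i) = 0)"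
  using assms
proof (induction J arbitrary: I A)
  case empty
  then have "I \<noteq> {}" by auto
  then show ?case by (intro exI[of _ "\<lambda>_. 1"]) auto
next
  case (insert j J)
  show ?case
  proof (cases "\<forall>i\<in>I. A j i = 0")
    case True
    have "card J < card I" using insert by simp
    from insert.IH[OF insert.prems(1) this, of A] obtain c
      where "\<exists>i\<in>I. c i \<noteq> 0" "\<forall>j\<in>J. (\<Sum>i\<in>I. A j i * c i) = 0" by blast
    with True show ?thesis by (intro exI[of _ c]) auto
  next
    case False
    then obtain i0 where i0: "i0 \<in> I" "A j i0 \<noteq> 0" by blast
    define A' where "A' k i = A k i - A k i0 * A j i / A j i0" for k i
    have "card J < card (I - {i0})" using insert i0 by simp
    from insert.IH[OF _ this, of A'] insert.prems obtain c
      where c: "\<exists>i\<in>I - {i0}. c i \<noteq> 0" "\<forall>k\<in>J. (\<Sum>i\<in>I - {i0}. A' k i * c i) = 0" by auto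
    define s where "s = (\<Sum>i\<in>I - {i0}. A j i * c i)"
    define c' where "c' = c(i0 := - s / A j i0)"
    have split: "(\<Sum>i\<in>I. A k i * c' i) = A k i0 * c' i0 + (\<Sum>i\<in>I - {i0}. A k i * c i)" for k
    proof -
      have "(\<Sum>i\<in>I. A k i * c' i) = A k i0 * c' i0 + (\<Sum>i\<in>I - {i0}. A k i * c' i)"
        using insert.prems i0 by (simp add: sum.remove)
      also have "(\<Sum>i\<in>I - {i0}. A k i * c' i) = (\<Sum>i\<in>I - {i0}. A k i * c i)"
        by (rule sum.cong) (auto simp: c'_def)
      finally show ?thesis .
    qed
    have "(\<Sum>i\<in>I. A k i * c' i) = 0" if "k \<in> insert j J" for k
    proof (cases "k = j")
      case True
      then show ?thesis using split[of j] i0 by (simp add: c'_def s_def)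
    next
      case False
      then have "(\<Sum>i\<in>I - {i0}. A' k i * c i) = 0" using c that by blast
      moreover have "(\<Sum>i\<in>I - {i0}. A' k i * c i)
          = (\<Sum>i\<in>I - {i0}. A k i * c i) - A k i0 / A j i0 * s"
        unfolding s_def A'_def
        by (simp add: sum_distrib_left sum_subtractf[symmetric] algebra_simps)
      ultimately show ?thesis using split[of k] by (simp add: c'_def)
    qed
    moreover have "\<exists>i\<in>I. c' i \<noteq> 0" using c(1) by (auto simp: c'_def)
    ultimately show ?thesis by blast
  qed
qed

text \<open>
  The elements of an inclusion-minimal determining subfamily come with dual vectors: dropping one
  functional lets some nonzero assignment through, and every other member of the subfamily vanishes
  on it. The predicate \<open>P\<close> collects constraints that are imposed throughout. This is how independence
  of rows of a rigidity matrix is used below, both for counting edges and for perturbing frameworks.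
\<close>

lemma minimal_determining_subfamily:
  fixes f :: "'i \<Rightarrow> ('v \<Rightarrow> 'a::zero) \<Rightarrow> real"
  assumes "finite I" and "\<And>m. P m \<Longrightarrow> \<forall>i\<in>I. f i m = 0 \<Longrightarrow> \<forall>v\<in>V. m v = 0"
  obtains F d where "F \<subseteq> I"
    and "\<And>m. P m \<Longrightarrow> \<forall>i\<in>F. f i m = 0 \<Longrightarrow> \<forall>v\<in>V. m v = 0"
    and "\<And>i. i \<in> F \<Longrightarrow> P (d i) \<and> \<not> (\<forall>v\<in>V. d i v = 0) \<and> (\<forall>j\<in>F - {i}. f j (d i) = 0)"
proof -
  let ?D = "\<lambda>F. \<forall>m. P m \<longrightarrow> (\<forall>i\<in>F. f i m = 0) \<longrightarrow> (\<forall>v\<in>V. m v = 0)"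
  obtain F where F: "F \<subseteq> I" "?D F" and min: "\<And>F'. F' \<subseteq> I \<Longrightarrow> ?D F' \<Longrightarrow> card F \<le> card F'"
    using ex_has_least_nat[of "\<lambda>F. F \<subseteq> I \<and> ?D F" I card] assms(2) by auto
  have "\<exists>m. P m \<and> \<not> (\<forall>v\<in>V. m v = 0) \<and> (\<forall>j\<in>F - {i}. f j m = 0)" if "i \<in> F" for i
  proof -
    have "card (F - {i}) < card F"
      using that F assms(1) by (meson card_Diff1_less finite_subset)
    then have "\<not> ?D (F - {i})" using min[of "F - {i}"] F(1) by (meson Diff_subset leD order_trans)
    then show ?thesis by blast
  qed
  then have "\<forall>i\<in>F. \<exists>m. P m \<and> \<not> (\<forall>v\<in>V. m v = 0) \<and> (\<forall>j\<in>F - {i}. f j m = 0)" by blast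
  from bchoice[OF this] obtain d
    where d: "\<forall>i\<in>F. P (d i) \<and> \<not> (\<forall>v\<in>V. d i v = 0) \<and> (\<forall>j\<in>F - {i}. f j (d i) = 0)" ..
  show thesis
  proof (rule that[OF F(1)])
    show "\<forall>v\<in>V. m v = 0" if "P m" "\<forall>i\<in>F. f i m = 0" for m
      using F(2) that by (elim allE[of _ m]) simp
    show "P (d i) \<and> \<not> (\<forall>v\<in>V. d i v = 0) \<and> (\<forall>j\<in>F - {i}. f j (d i) = 0)" if "i \<in> F" for i
      using d that by simp
  qed
qed

text \<open>
  Rigidity survives small perturbations because having trivial kernel is an open condition. With a
  minimal determining subfamily \<open>F\<close> and its dual vectors \<open>d i\<close>, every \<open>m\<close> agrees on \<open>V\<close> with
  \<open>\<Sum>i\<in>F. (f i m / f i (d i)) d i\<close>. If \<open>m\<close> is in the perturbed kernel, the coefficients are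
  \<open>t\<close> times something bounded by the size of \<open>m\<close>, so for small \<open>t\<close> the size of \<open>m\<close> is bounded by a
  fraction of itself.
\<close>

lemma trivial_kernel_stable:
  fixes f g :: "'i \<Rightarrow> ('v \<Rightarrow> 'a::real_normed_vector) \<Rightarrow> real"
  assumes fin: "finite I" "finite V"
    and lin: "\<And>i. i \<in> I \<Longrightarrow> linear_functional (f i)"
    and bound: "\<And>i m. i \<in> I \<Longrightarrow> \<bar>g i m\<bar> \<le> C i * (\<Sum>v\<in>V. norm (m v))"
    and kernel: "\<And>m. \<forall>i\<in>I. f i m = 0 \<Longrightarrow> \<forall>v\<in>V. m v = 0"
  shows "\<exists>\<epsilon>>0. \<forall>t. \<bar>t\<bar> < \<epsilon> \<longrightarrow> (\<forall>m. (\<forall>i\<in>I. f i m + t * g i m = 0) \<longrightarrow> (\<forall>v\<in>V. m v = 0))"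
proof -
  obtain F d where F: "F \<subseteq> I" and kerF: "\<And>m. \<forall>i\<in>F. f i m = 0 \<Longrightarrow> \<forall>v\<in>V. m v = 0"
    and d: "\<And>i. i \<in> F \<Longrightarrow> \<not> (\<forall>v\<in>V. d i v = 0) \<and> (\<forall>j\<in>F - {i}. f j (d i) = 0)"
    by (rule minimal_determining_subfamily[of I "\<lambda>_. True" f V]) (use fin kernel in auto)
  have finF: "finite F" using F fin finite_subset by blast
  have nz: "f i (d i) \<noteq> 0" if "i \<in> F" for i
    using kerF[of "d i"] d[OF that] by auto
  define N where "N m = (\<Sum>v\<in>V. norm (m v))" for m :: "'v \<Rightarrow> 'a"
  have N0: "N m \<ge> 0" for m unfolding N_def by (simp add: sum_nonneg)
  have expand: "m v = (\<Sum>i\<in>F. (f i m / f i (d i)) *\<^sub>R d i v)" if "v \<in> V" for m v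
  proof -
    define h where "h v = m v - (\<Sum>i\<in>F. (f i m / f i (d i)) *\<^sub>R d i v)" for v
    have "f j h = 0" if j: "j \<in> F" for j
    proof -
      have L: "linear_functional (f j)" using lin F j by blast
      have "f j h = f j m - f j (\<lambda>v. \<Sum>i\<in>F. (f i m / f i (d i)) *\<^sub>R d i v)"
        unfolding h_def by (rule linear_functional_diff[OF L])
      also have "\<dots> = f j m - (\<Sum>i\<in>F. f i m / f i (d i) * f j (d i))"
        by (simp add: linear_functional_sum[OF L finF])
      also have "(\<Sum>i\<in>F. f i m / f i (d i) * f j (d i))
          = (\<Sum>i\<in>F. if i = j then f j m else 0)"
        by (rule sum.cong) (use d nz j in auto)
      finally show ?thesis using finF j by simp
    qed
    then have "h v = 0" using kerF[of h] that by blast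
    then show ?thesis by (simp add: h_def)
  qed
  define K where "K = (\<Sum>i\<in>F. \<bar>C i\<bar> / \<bar>f i (d i)\<bar> * N (d i))"
  have K0: "K \<ge> 0" unfolding K_def by (intro sum_nonneg) (simp add: N0)
  have "\<forall>v\<in>V. m v = 0" if t: "\<bar>t\<bar> < 1 / (K + 1)" and m: "\<forall>i\<in>I. f i m + t * g i m = 0" for t m
  proof -
    have "N m \<le> (\<Sum>v\<in>V. \<Sum>i\<in>F. \<bar>f i m / f i (d i)\<bar> * norm (d i v))"
      unfolding N_def
    proof (rule sum_mono)
      fix v assume "v \<in> V"
      then have "norm (m v) = norm (\<Sum>i\<in>F. (f i m / f i (d i)) *\<^sub>R d i v)" using expand by metis
      also have "\<dots> \<le> (\<Sum>i\<in>F. norm ((f i m / f i (d i)) *\<^sub>R d i v))" by (rule norm_sum)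
      finally show "norm (m v) \<le> (\<Sum>i\<in>F. \<bar>f i m / f i (d i)\<bar> * norm (d i v))" by simp
    qed
    also have "\<dots> = (\<Sum>i\<in>F. \<bar>f i m\<bar> / \<bar>f i (d i)\<bar> * N (d i))"
      by (subst sum.swap) (simp add: N_def sum_distrib_left)
    also have "\<dots> \<le> (\<Sum>i\<in>F. \<bar>t\<bar> * N m * (\<bar>C i\<bar> / \<bar>f i (d i)\<bar> * N (d i)))"
    proof (rule sum_mono)
      fix i assume i: "i \<in> F"
      have "f i m = - t * g i m" using m i F by (auto simp: algebra_simps add_eq_0_iff)
      then have "\<bar>f i m\<bar> = \<bar>t\<bar> * \<bar>g i m\<bar>" by (simp add: abs_mult)
      also have "\<dots> \<le> \<bar>t\<bar> * (\<bar>C i\<bar> * N m)"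
      proof (rule mult_left_mono)
        have "\<bar>g i m\<bar> \<le> C i * N m" using bound i F unfolding N_def by blast
        also have "\<dots> \<le> \<bar>C i\<bar> * N m" using N0 by (intro mult_right_mono) auto
        finally show "\<bar>g i m\<bar> \<le> \<bar>C i\<bar> * N m" .
      qed simp
      finally have "\<bar>f i m\<bar> / \<bar>f i (d i)\<bar> * N (d i) \<le> \<bar>t\<bar> * (\<bar>C i\<bar> * N m) / \<bar>f i (d i)\<bar> * N (d i)"
        by (intro mult_right_mono divide_right_mono) (auto simp: N0)
      then show "\<bar>f i m\<bar> / \<bar>f i (d i)\<bar> * N (d i) \<le> \<bar>t\<bar> * N m * (\<bar>C i\<bar> / \<bar>f i (d i)\<bar> * N (d i))"
        by (simp add: algebra_simps)
    qed
    also have "\<dots> = \<bar>t\<bar> * K * N m" by (simp add: K_def sum_distrib_left algebra_simps)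
    finally have "N m \<le> \<bar>t\<bar> * K * N m" .
    moreover have "\<bar>t\<bar> * K < 1"
    proof -
      have "\<bar>t\<bar> * (K + 1) < 1" using t K0 by (simp add: pos_less_divide_eq)
      then show ?thesis by (simp add: algebra_simps)
    qed
    ultimately have "N m = 0" using N0[of m]
      by (smt (verit) mult_less_cancel_right2)
    then show ?thesis using fin unfolding N_def by (simp add: sum_nonneg_eq_0_iff)
  qed
  moreover have "1 / (K + 1) > 0" using K0 by simp
  ultimately show ?thesis by blast
qed

section \<open>Triple products\<close>

definition triple :: "real ^ 3 \<Rightarrow> real ^ 3 \<Rightarrow> real ^ 3 \<Rightarrow> real" where
  "triple x y z = x \<bullet> cross3 y z"

lemmas triple_expand = triple_def cross3_def inner_vec_def sum_3

lemma triple_nonzero_imp_orthogonal_zero: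
  assumes "triple x y z \<noteq> 0" "x \<bullet> m = 0" "y \<bullet> m = 0" "z \<bullet> m = 0"
  shows "m = 0"
proof -
  have "triple x y z *\<^sub>R m =
      (x \<bullet> m) *\<^sub>R cross3 y z + (y \<bullet> m) *\<^sub>R cross3 z x + (z \<bullet> m) *\<^sub>R cross3 x y"
    by (simp add: vec_eq_iff forall_3 triple_expand algebra_simps)
  then show ?thesis using assms by simp
qed

lemma nonzero_extends_to_triple:
  assumes "x \<noteq> 0" shows "\<exists>y z. triple x y z \<noteq> 0"
proof -
  have "x $ 1 \<noteq> 0 \<or> x $ 2 \<noteq> 0 \<or> x $ 3 \<noteq> 0" using assms by (auto simp: vec_eq_iff forall_3)
  moreover have "triple x (axis 2 1) (axis 3 1) = x $ 1" "triple x (axis 3 1) (axis 1 1) = x $ 2"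
    "triple x (axis 1 1) (axis 2 1) = x $ 3"
    by (simp_all add: triple_expand axis_def)
  ultimately show ?thesis by metis
qed

text \<open>
  Along a line the triple product is a cubic polynomial in the parameter whose leading coefficient is
  the triple product of the directions. All general position arguments reduce to this: one exhibits a
  single direction of movement with nonzero leading coefficient.
\<close>

lemma finite_triple_roots:
  assumes "triple x' y' z' \<noteq> 0"
  shows "finite {t. triple (x + t *\<^sub>R x') (y + t *\<^sub>R y') (z + t *\<^sub>R z') = 0}"
proof -
  define P where "P = [: triple x y z, triple x' y z + triple x y' z + triple x y z',
    triple x' y' z + triple x' y z' + triple x y' z', triple x' y' z' :]"
  have "triple (x + t *\<^sub>R x') (y + t *\<^sub>R y') (z + t *\<^sub>R z') = poly P t" for t
    unfolding P_def by (simp add: triple_expand algebra_simps)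
  moreover have "P \<noteq> 0" using assms by (simp add: P_def)
  ultimately show ?thesis using poly_roots_finite[of P] by simp
qed

section \<open>Frameworks on simple graphs with loop multiplicities\<close>

definition simple_edges :: "'v set \<Rightarrow> 'v set set \<Rightarrow> bool" where
  "simple_edges V E \<longleftrightarrow> finite V \<and> (\<forall>e\<in>E. e \<subseteq> V \<and> card e = 2)"

text \<open>
  For the induction a looped simple graph is given by its vertices \<open>V\<close>, its edges \<open>E\<close> as two-element
  sets, and the number \<open>l v\<close> of loops at each vertex. The normals at \<open>v\<close> are \<open>q v 0, \<dots>, q v (l v)\<close>:
  number \<open>0\<close> belongs to the additional loop that every vertex receives.
\<close>

definition motion ::
  "'v set \<Rightarrow> 'v set set \<Rightarrow> ('v \<Rightarrow> nat) \<Rightarrow> ('v \<Rightarrow> real ^ 3) \<Rightarrow> ('v \<Rightarrow> nat \<Rightarrow> real ^ 3) \<Rightarrow>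
    ('v \<Rightarrow> real ^ 3) \<Rightarrow> bool" where
  "motion V E l p q m \<longleftrightarrow>
     (\<forall>u v. {u, v} \<in> E \<longrightarrow> (p u - p v) \<bullet> (m u - m v) = 0) \<and>
     (\<forall>v\<in>V. \<forall>i\<le>l v. q v i \<bullet> m v = 0)"

definition rigid ::
  "'v set \<Rightarrow> 'v set set \<Rightarrow> ('v \<Rightarrow> nat) \<Rightarrow> ('v \<Rightarrow> real ^ 3) \<Rightarrow> ('v \<Rightarrow> nat \<Rightarrow> real ^ 3) \<Rightarrow> bool" where
  "rigid V E l p q \<longleftrightarrow> (\<forall>m. motion V E l p q m \<longrightarrow> (\<forall>v\<in>V. m v = 0))"

lemma simple_edgesD:
  assumes "simple_edges V E" "{u, v} \<in> E"
  shows "u \<in> V" "v \<in> V" "u \<noteq> v"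
  using assms unfolding simple_edges_def by force+

lemma simple_edges_finite: "simple_edges V E \<Longrightarrow> finite E"
  unfolding simple_edges_def by (meson PowI finite_Pow_iff finite_subset subsetI)

lemma rigid_stable:
  fixes p p' :: "'v \<Rightarrow> real ^ 3" and q q' :: "'v \<Rightarrow> nat \<Rightarrow> real ^ 3"
  assumes simple: "simple_edges V E" and rigid: "rigid V E l p q"
  shows "\<exists>\<epsilon>>0. \<forall>t. \<bar>t\<bar> < \<epsilon> \<longrightarrow>
           rigid V E l (\<lambda>v. p v + t *\<^sub>R p' v) (\<lambda>v i. q v i + t *\<^sub>R q' v i)"
proof -
  define row :: "('v \<Rightarrow> real ^ 3) \<Rightarrow> ('v \<Rightarrow> nat \<Rightarrow> real ^ 3) \<Rightarrow> ('v \<times> 'v) + ('v \<times> nat) \<Rightarrow>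
      ('v \<Rightarrow> real ^ 3) \<Rightarrow> real"
    where "row p q i m = (case i of Inl (u, v) \<Rightarrow> (p u - p v) \<bullet> (m u - m v)
                                  | Inr (v, k) \<Rightarrow> q v k \<bullet> m v)" for p q i m
  define I where "I = Inl ` {(u, v) \<in> V \<times> V. {u, v} \<in> E} \<union> Inr ` Sigma V (\<lambda>v. {..l v})"
  have finV: "finite V" using simple by (simp add: simple_edges_def)
  have motion_iff: "motion V E l p q m \<longleftrightarrow> (\<forall>i\<in>I. row p q i m = 0)" for p q m
    unfolding motion_def I_def row_def using simple_edgesD[OF simple] by (auto simp: ball_Un)
  have row_add: "row (\<lambda>v. p v + t *\<^sub>R p' v) (\<lambda>v i. q v i + t *\<^sub>R q' v i) i m
      = row p q i m + t * row p' q' i m" for t i m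
    unfolding row_def by (auto split: sum.splits simp: algebra_simps inner_simps)
  have "\<exists>C. \<forall>m. \<bar>row p' q' i m\<bar> \<le> C * (\<Sum>v\<in>V. norm (m v))" if "i \<in> I" for i
  proof -
    have le: "norm (m v) \<le> (\<Sum>v\<in>V. norm (m v))" if "v \<in> V" for m :: "'v \<Rightarrow> real ^ 3" and v
      using that finV by (intro member_le_sum) auto
    consider u v where "i = Inl (u, v)" "u \<in> V" "v \<in> V" | v k where "i = Inr (v, k)" "v \<in> V"
      using \<open>i \<in> I\<close> by (auto simp: I_def)
    then show ?thesis
    proof cases
      case 1
      have "\<bar>row p' q' i m\<bar> \<le> norm (p' u - p' v) * 2 * (\<Sum>v\<in>V. norm (m v))" for m
      proof -
        have "\<bar>row p' q' i m\<bar> \<le> norm (p' u - p' v) * norm (m u - m v)"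
          unfolding row_def 1 by (simp add: Cauchy_Schwarz_ineq2)
        also have "norm (m u - m v) \<le> 2 * (\<Sum>v\<in>V. norm (m v))"
          using norm_triangle_ineq4[of "m u" "m v"] le[of u m] le[of v m] 1 by linarith
        finally show ?thesis by (simp add: mult_left_mono)
      qed
      then show ?thesis by blast
    next
      case 2
      have "\<bar>row p' q' i m\<bar> \<le> norm (q' v k) * (\<Sum>v\<in>V. norm (m v))" for m
      proof -
        have "\<bar>row p' q' i m\<bar> \<le> norm (q' v k) * norm (m v)"
          unfolding row_def 2 by (simp add: Cauchy_Schwarz_ineq2)
        also have "\<dots> \<le> norm (q' v k) * (\<Sum>v\<in>V. norm (m v))"
          using le 2 by (intro mult_left_mono) auto
        finally show ?thesis .
      qed
      then show ?thesis by blast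
    qed
  qed
  then obtain C where "\<And>i m. i \<in> I \<Longrightarrow> \<bar>row p' q' i m\<bar> \<le> C i * (\<Sum>v\<in>V. norm (m v))"
    by metis
  moreover have "finite I" using finV unfolding I_def
    by (auto intro!: finite_imageI intro: finite_subset[of _ "V \<times> V"])
  moreover have "linear_functional (row p q i)" for i
    unfolding linear_functional_def row_def by (auto split: sum.splits simp: algebra_simps inner_simps)
  moreover have "\<forall>v\<in>V. m v = 0" if "\<forall>i\<in>I. row p q i m = 0" for m
    using rigid that motion_iff unfolding rigid_def by blast
  ultimately obtain \<epsilon> where "\<epsilon> > 0"
    "\<forall>t. \<bar>t\<bar> < \<epsilon> \<longrightarrow> (\<forall>m. (\<forall>i\<in>I. row p q i m + t * row p' q' i m = 0) \<longrightarrow> (\<forall>v\<in>V. m v = 0))"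
    using trivial_kernel_stable[of I V "row p q" "row p' q'" C] finV by blast
  then show ?thesis unfolding rigid_def motion_iff row_add by blast
qed

text \<open>
  A rigid framework may be moved in any prescribed direction \<open>(p', q')\<close> so as to avoid finitely many
  bad parameters. Combined with \<open>finite_triple_roots\<close>, this puts it in the general position that the
  next vertex needs.
\<close>

lemma rigid_generic:
  assumes "simple_edges V E" "rigid V E l p q" "finite Z"
  obtains t where "t \<notin> Z" "rigid V E l (\<lambda>v. p v + t *\<^sub>R p' v) (\<lambda>v i. q v i + t *\<^sub>R q' v i)"
proof -
  obtain \<epsilon> where "\<epsilon> > 0"
    and \<epsilon>: "\<And>t. \<bar>t\<bar> < \<epsilon> \<Longrightarrow> rigid V E l (\<lambda>v. p v + t *\<^sub>R p' v) (\<lambda>v i. q v i + t *\<^sub>R q' v i)"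
    using rigid_stable[OF assms(1,2), of p' q'] by blast
  then have "infinite {0<..<\<epsilon>}" by (simp add: infinite_Ioo)
  then have "infinite ({0<..<\<epsilon>} - Z)" using assms(3) by (rule Diff_infinite_finite[rotated])
  then obtain t where "t \<in> {0<..<\<epsilon>} - Z" by (metis ex_in_conv finite.emptyI)
  then show thesis using \<epsilon>[of t] by (intro that[of t]) auto
qed

section \<open>Counting edges and loops\<close>

definition load :: "'v set set \<Rightarrow> ('v \<Rightarrow> nat) \<Rightarrow> 'v set \<Rightarrow> nat" where
  "load E l X = card {e \<in> E. e \<subseteq> X} + sum l X"

definition nbrs :: "'v set set \<Rightarrow> 'v \<Rightarrow> 'v set" where
  "nbrs E v = {u. {u, v} \<in> E}"

definition remove_vertex :: "'v \<Rightarrow> 'v set set \<Rightarrow> 'v set set" where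
  "remove_vertex v E = {e \<in> E. v \<notin> e}"

text \<open>
  The sparsity condition is imposed on vertex sets instead of edge sets: among all \<open>F\<close> whose incident
  vertices lie in \<open>X\<close>, the largest consists of all edges and loops inside \<open>X\<close>.
\<close>

definition tight :: "'v set \<Rightarrow> 'v set set \<Rightarrow> ('v \<Rightarrow> nat) \<Rightarrow> bool" where
  "tight V E l \<longleftrightarrow> simple_edges V E \<and> (\<forall>X\<subseteq>V. load E l X \<le> 2 * card X) \<and> load E l V = 2 * card V"

definition K5_free :: "'v set set \<Rightarrow> bool" where
  "K5_free E \<longleftrightarrow> (\<forall>X. card X = 5 \<longrightarrow> (\<exists>u\<in>X. \<exists>v\<in>X. u \<noteq> v \<and> {u, v} \<notin> E))"

lemma nbrs_subset: "simple_edges V E \<Longrightarrow> nbrs E v \<subseteq> V - {v}"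
  unfolding nbrs_def by (auto dest: simple_edgesD)

lemma finite_nbrs: "simple_edges V E \<Longrightarrow> finite (nbrs E v)"
  by (meson finite_Diff finite_subset nbrs_subset simple_edges_def)

lemma card_edges_at:
  assumes "simple_edges V E"
  shows "card {e \<in> E. v \<in> e} = card (nbrs E v)"
proof -
  have "inj_on (\<lambda>u. {u, v}) (nbrs E v)"
    by (auto simp: inj_on_def doubleton_eq_iff)
  moreover have "(\<lambda>u. {u, v}) ` nbrs E v = {e \<in> E. v \<in> e}"
  proof (intro equalityI subsetI)
    fix e assume e: "e \<in> {e \<in> E. v \<in> e}"
    then have "card e = 2" using assms by (auto simp: simple_edges_def)
    then obtain u where "e = {u, v}" using e by (auto simp: card_2_iff)
    then show "e \<in> (\<lambda>u. {u, v}) ` nbrs E v" using e by (auto simp: nbrs_def)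
  qed (auto simp: nbrs_def)
  ultimately show ?thesis using card_image by metis
qed

lemma handshake:
  assumes "simple_edges V E" "X \<subseteq> V"
  shows "(\<Sum>v\<in>X. card (nbrs E v)) = (\<Sum>e\<in>E. card (e \<inter> X))"
proof -
  have fin: "finite X" "finite E"
    using assms simple_edges_finite finite_subset by (auto simp: simple_edges_def)
  have "(\<Sum>v\<in>X. card (nbrs E v)) = (\<Sum>v\<in>X. \<Sum>e\<in>E. if v \<in> e then 1 else 0)"
    using fin by (simp add: card_edges_at[OF assms(1), symmetric] sum.If_cases Int_def)
  also have "\<dots> = (\<Sum>e\<in>E. \<Sum>v\<in>X. if v \<in> e then 1 else 0)" by (rule sum.swap)
  also have "\<dots> = (\<Sum>e\<in>E. card (e \<inter> X))"
    using fin by (simp add: sum.If_cases Int_def conj_commute)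
  finally show ?thesis .
qed

lemma load_insert_vertex:
  assumes "simple_edges V E" "finite X" "v \<notin> X"
  shows "load E l (insert v X) = load E l X + card (nbrs E v \<inter> X) + l v"
proof -
  have fin: "finite E" using assms simple_edges_finite by blast
  have "{e \<in> E. e \<subseteq> insert v X} = {e \<in> E. e \<subseteq> X} \<union> (\<lambda>u. {u, v}) ` (nbrs E v \<inter> X)"
  proof (intro equalityI subsetI)
    fix e assume e: "e \<in> {e \<in> E. e \<subseteq> insert v X}"
    show "e \<in> {e \<in> E. e \<subseteq> X} \<union> (\<lambda>u. {u, v}) ` (nbrs E v \<inter> X)"
    proof (cases "v \<in> e")
      case True
      have "card e = 2" using e assms by (auto simp: simple_edges_def)
      then obtain u where "e = {u, v}" "u \<noteq> v" using True by (auto simp: card_2_iff)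
      then show ?thesis using e by (auto simp: nbrs_def)
    qed (use e in auto)
  qed (auto simp: nbrs_def)
  moreover have "{e \<in> E. e \<subseteq> X} \<inter> (\<lambda>u. {u, v}) ` (nbrs E v \<inter> X) = {}"
    using assms(3) by auto
  moreover have "card ((\<lambda>u. {u, v}) ` (nbrs E v \<inter> X)) = card (nbrs E v \<inter> X)"
    by (rule card_image) (auto simp: inj_on_def doubleton_eq_iff)
  ultimately have "card {e \<in> E. e \<subseteq> insert v X} = card {e \<in> E. e \<subseteq> X} + card (nbrs E v \<inter> X)"
    using fin assms(2) by (simp add: card_Un_disjoint)
  then show ?thesis using assms by (simp add: load_def)
qed

lemma load_remove_vertex:
  assumes "v \<notin> X"
  shows "load (remove_vertex v E) l X = load E l X"
proof -
  have "{e \<in> remove_vertex v E. e \<subseteq> X} = {e \<in> E. e \<subseteq> X}"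
    using assms by (auto simp: remove_vertex_def)
  then show ?thesis by (simp add: load_def)
qed

lemma load_add_loop:
  assumes "finite X"
  shows "load E (l(a := Suc (l a))) X = load E l X + (if a \<in> X then 1 else 0)"
proof -
  have "sum (l(a := Suc (l a))) X = (\<Sum>v\<in>X. l v + (if v = a then 1 else 0))"
    by (rule sum.cong) auto
  then show ?thesis using assms by (simp add: load_def sum.distrib)
qed

text \<open>
  An edge with both ends in \<open>X\<close> or both in \<open>Y\<close> is counted equally often on both sides; an edge
  between the two differences is counted only on the right. Hence the union of two sets of load
  \<open>2 |X|\<close> and \<open>2 |Y|\<close> again has the maximal load that sparsity permits.
\<close>

lemma load_supermodular:
  assumes "finite E" "finite X" "finite Y"
  shows "load E l X + load E l Y \<le> load E l (X \<union> Y) + load E l (X \<inter> Y)"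
proof -
  let ?A = "\<lambda>Z. {e \<in> E. e \<subseteq> Z}"
  have "card (?A X) + card (?A Y) = card (?A X \<union> ?A Y) + card (?A X \<inter> ?A Y)"
    using assms(1) by (intro card_Un_Int) auto
  also have "\<dots> \<le> card (?A (X \<union> Y)) + card (?A (X \<inter> Y))"
    using assms(1) by (intro add_mono card_mono) auto
  finally show ?thesis using sum.union_inter[OF assms(2,3), of l] by (simp add: load_def)
qed

lemma simple_edges_remove_vertex:
  "simple_edges V E \<Longrightarrow> simple_edges (V - {v}) (remove_vertex v E)"
  by (auto simp: simple_edges_def remove_vertex_def)

lemma K5_free_remove_vertex: "K5_free E \<Longrightarrow> K5_free (remove_vertex v E)"
  unfolding K5_free_def remove_vertex_def by blast

lemma tight_vertex_load:
  assumes "tight V E l" "v \<in> V"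
  shows "load E l (V - {v}) + card (nbrs E v) + l v = 2 * card (V - {v}) + 2"
proof -
  have simple: "simple_edges V E" and fin: "finite V"
    using assms by (auto simp: tight_def simple_edges_def)
  have "load E l V = load E l (V - {v}) + card (nbrs E v) + l v"
    using load_insert_vertex[OF simple, of "V - {v}" v l] nbrs_subset[OF simple, of v] assms(2) fin
    by (simp add: insert_absorb Int_absorb2)
  moreover have "card V = card (V - {v}) + 1"
    using assms(2) fin by (metis Suc_eq_plus1 card_Suc_Diff1)
  ultimately show ?thesis using assms(1) by (simp add: tight_def)
qed

lemma tight_min_degree:
  assumes "tight V E l" "v \<in> V" shows "2 \<le> card (nbrs E v) + l v"
proof -
  have "load E l (V - {v}) \<le> 2 * card (V - {v})" using assms(1) by (simp add: tight_def)
  then show ?thesis using tight_vertex_load[OF assms] by linarith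
qed

text \<open>
  By the handshake identity, \<open>\<Sum>v. deg v + 2 l v = 2 (|E| + \<Sum>v. l v) = 4 |V|\<close>. Thus if no vertex has
  \<open>deg v + l v \<le> 3\<close>, equality holds everywhere.
\<close>

lemma tight_low_degree_or_regular:
  assumes "tight V E l"
  shows "(\<exists>v\<in>V. card (nbrs E v) + l v \<le> 3) \<or> (\<forall>v\<in>V. card (nbrs E v) = 4 \<and> l v = 0)"
proof (rule disjCI)
  assume no: "\<not> (\<forall>v\<in>V. card (nbrs E v) = 4 \<and> l v = 0)"
  have simple: "simple_edges V E" and fin: "finite V"
    using assms by (auto simp: tight_def simple_edges_def)
  have eE: "{e \<in> E. e \<subseteq> V} = E" using simple by (auto simp: simple_edges_def)
  have "(\<Sum>v\<in>V. card (nbrs E v)) = (\<Sum>e\<in>E. 2)"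
    unfolding handshake[OF simple order_refl]
    by (rule sum.cong) (use simple in \<open>auto simp: simple_edges_def Int_absorb2\<close>)
  then have sum4: "(\<Sum>v\<in>V. card (nbrs E v) + 2 * l v) = (\<Sum>v\<in>V. 4)"
    using assms by (simp add: tight_def load_def eE sum.distrib sum_distrib_left[symmetric])
  show "\<exists>v\<in>V. card (nbrs E v) + l v \<le> 3"
  proof (rule ccontr)
    assume "\<not> ?thesis"
    then have big: "\<And>v. v \<in> V \<Longrightarrow> 4 \<le> card (nbrs E v) + l v" by force
    obtain w where w: "w \<in> V" "card (nbrs E w) \<noteq> 4 \<or> l w \<noteq> 0" using no by blast
    have "(\<Sum>v\<in>V. 4) < (\<Sum>v\<in>V. card (nbrs E v) + 2 * l v)"
    proof (rule sum_strict_mono_ex1[OF fin])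
      show "\<forall>v\<in>V. 4 \<le> card (nbrs E v) + 2 * l v" using big by force
      show "\<exists>v\<in>V. 4 < card (nbrs E v) + 2 * l v" using big[OF w(1)] w by (intro bexI[of _ w]) auto
    qed
    then show False using sum4 by simp
  qed
qed

text \<open>
  When a vertex \<open>v\<close> of total degree three is removed, one more constraint is needed, and it can always
  be a loop at some neighbour. Otherwise every neighbour would lie in a set of maximal load
  avoiding \<open>v\<close>; the union \<open>W\<close> of these sets has maximal load too, and adding \<open>v\<close> with its three edges
  and loops to it violates sparsity.
\<close>

lemma obtain_loop_vertex:
  assumes tight: "tight V E l" and v: "v \<in> V" "card (nbrs E v) + l v = 3"
  obtains a where "a \<in> nbrs E v"
    and "\<And>X. X \<subseteq> V - {v} \<Longrightarrow> a \<in> X \<Longrightarrow> load E l X < 2 * card X"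
proof -
  have simple: "simple_edges V E" and fin: "finite V" "finite E"
    and sparse: "\<And>X. X \<subseteq> V \<Longrightarrow> load E l X \<le> 2 * card X"
    using tight simple_edges_finite by (auto simp: tight_def simple_edges_def)
  have "\<exists>a\<in>nbrs E v. \<forall>X. X \<subseteq> V - {v} \<longrightarrow> a \<in> X \<longrightarrow> load E l X < 2 * card X"
  proof (rule ccontr)
    assume "\<not> ?thesis"
    then have "\<forall>a\<in>nbrs E v. \<exists>X. X \<subseteq> V - {v} \<and> a \<in> X \<and> load E l X \<ge> 2 * card X"
      by (simp add: not_less)
    then obtain X where X: "\<And>a. a \<in> nbrs E v \<Longrightarrow>
        X a \<subseteq> V - {v} \<and> a \<in> X a \<and> load E l (X a) \<ge> 2 * card (X a)" by metis
    have U: "(\<Union>a\<in>A. X a) \<subseteq> V - {v} \<and> load E l (\<Union>a\<in>A. X a) \<ge> 2 * card (\<Union>a\<in>A. X a)"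
      if "finite A" "A \<subseteq> nbrs E v" for A
      using that
    proof (induction A)
      case empty
      then show ?case by simp
    next
      case (insert a A)
      let ?Y = "\<Union>a\<in>A. X a"
      have Y: "?Y \<subseteq> V - {v}" "load E l ?Y \<ge> 2 * card ?Y" using insert by auto
      have a: "X a \<subseteq> V - {v}" "load E l (X a) \<ge> 2 * card (X a)" using X insert by auto
      have fXY: "finite (X a)" "finite ?Y"
        using Y(1) a(1) fin(1) by (meson finite_Diff finite_subset)+
      have "load E l (X a) + load E l ?Y \<le> load E l (X a \<union> ?Y) + load E l (X a \<inter> ?Y)"
        by (rule load_supermodular[OF fin(2) fXY])
      moreover have "load E l (X a \<inter> ?Y) \<le> 2 * card (X a \<inter> ?Y)" using sparse a by blast
      moreover have "card (X a) + card ?Y = card (X a \<union> ?Y) + card (X a \<inter> ?Y)"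
        by (rule card_Un_Int[OF fXY])
      ultimately have "load E l (X a \<union> ?Y) \<ge> 2 * card (X a \<union> ?Y)" using Y a by linarith
      then show ?case using Y(1) a(1) by simp
    qed
    define W where "W = (\<Union>a\<in>nbrs E v. X a)"
    have W: "W \<subseteq> V - {v}" "load E l W \<ge> 2 * card W"
      using U[OF finite_nbrs[OF simple] order_refl] by (auto simp: W_def)
    have finW: "finite W" using W(1) fin(1) by (meson finite_Diff finite_subset)
    have "nbrs E v \<inter> W = nbrs E v" using X by (auto simp: W_def)
    moreover have vW: "v \<notin> W" using W(1) by blast
    ultimately have "load E l (insert v W) = load E l W + 3"
      using load_insert_vertex[OF simple finW, of v l] v(2) by simp
    moreover have "load E l (insert v W) \<le> 2 * card (insert v W)"
      by (rule sparse) (use W(1) v(1) in blast)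
    moreover have "card (insert v W) = card W + 1" using finW vW by simp
    ultimately show False using W(2) by linarith
  qed
  then show thesis using that by blast
qed

section \<open>Reinserting a vertex\<close>

lemma rigidI_vertex:
  assumes "\<And>m. motion V E l p q m \<Longrightarrow> \<forall>u\<in>V - {v}. m u = 0" "v \<in> V" "nbrs E v \<subseteq> V - {v}"
    and "\<And>y. \<forall>b\<in>nbrs E v. (p v - p b) \<bullet> y = 0 \<Longrightarrow> \<forall>i\<le>l v. q v i \<bullet> y = 0 \<Longrightarrow> y = 0"
  shows "rigid V E l p q"
  unfolding rigid_def
proof (intro allI impI)
  fix m assume m: "motion V E l p q m"
  then have rest: "\<forall>u\<in>V - {v}. m u = 0" by (rule assms(1))
  have "m v = 0"
  proof (rule assms(4))
    show "\<forall>i\<le>l v. q v i \<bullet> m v = 0" using m assms(2) by (simp add: motion_def)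
    show "\<forall>b\<in>nbrs E v. (p v - p b) \<bullet> m v = 0"
    proof
      fix b assume b: "b \<in> nbrs E v"
      then have "{v, b} \<in> E" by (simp add: nbrs_def insert_commute)
      then have "(p v - p b) \<bullet> (m v - m b) = 0" using m by (simp add: motion_def)
      moreover have "m b = 0" using rest assms(3) b by blast
      ultimately show "(p v - p b) \<bullet> m v = 0" by simp
    qed
  qed
  with rest show "\<forall>u\<in>V. m u = 0" by blast
qed

text \<open>
  A star at \<open>a\<close> with \<open>k\<close> loops spans if its edge directions, the normals \<open>r 1, \<dots>, r k\<close> and the extra
  vector \<open>n\<close> admit no common orthogonal vector.
\<close>

definition spanning_star ::
  "'v \<Rightarrow> 'v set \<Rightarrow> nat \<Rightarrow> ('v \<Rightarrow> real ^ 3) \<Rightarrow> (nat \<Rightarrow> real ^ 3) \<Rightarrow> real ^ 3 \<Rightarrow> bool" where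
  "spanning_star a B k p r n \<longleftrightarrow>
     (\<forall>y. n \<bullet> y = 0 \<longrightarrow> (\<forall>b\<in>B. (p b - p a) \<bullet> y = 0) \<longrightarrow> (\<forall>i\<in>{1..k}. r i \<bullet> y = 0) \<longrightarrow> y = 0)"

text \<open>
  Two edges or loops and the extra vector \<open>n\<close> are generically a basis. The directions of movement are
  chosen as the three coordinate axes, one for \<open>n\<close> and one for each edge, and the normals of the loops
  are the axes left over. Since \<open>r\<close> does not depend on the parameter \<open>t\<close>, a normal is replaced by \<open>t\<close>
  times itself when the triple product is formed.
\<close>

lemma spanning_star_generic:
  assumes "finite B" "a \<notin> B" "card B + k = 2"
  obtains p' :: "'v \<Rightarrow> real ^ 3" and r :: "nat \<Rightarrow> real ^ 3" where
    "\<And>p n. finite {t. \<not> spanning_star a B k (\<lambda>v. p v + t *\<^sub>R p' v) r (n + t *\<^sub>R axis 3 1)}"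
proof -
  have unit: "triple (axis 1 1) (axis 2 1) (axis 3 1) \<noteq> 0"
    by (simp add: triple_expand axis_def)
  have star: "finite {t. \<not> S t}"
    if "\<And>t. triple (w1 + t *\<^sub>R axis 1 1) (w2 + t *\<^sub>R axis 2 1) (n + t *\<^sub>R axis 3 1) \<noteq> 0 \<Longrightarrow> S t"
    for S and w1 w2 n :: "real ^ 3"
    by (rule finite_subset[OF _ finite_triple_roots[OF unit, of w1 w2 n]]) (use that in blast)
  consider b c where "B = {b, c}" "b \<noteq> c" "k = 0" | b where "B = {b}" "k = 1" | "B = {}" "k = 2"
  proof -
    consider "card B = 0" | "card B = 1" | "card B = 2" using assms(3) by linarith
    then show thesis
    proof cases
      case 1
      then show thesis using that(3) assms by simp
    next
      case 2
      then obtain b where "B = {b}" by (rule card_1_singletonE)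
      then show thesis using that(2)[of b] assms(3) by simp
    next
      case 3
      then show thesis using that(1) assms(3) by (metis add_cancel_left_right card_2_iff)
    qed
  qed
  then show thesis
  proof cases
    case 1
    let ?p' = "((\<lambda>_. 0)(b := axis 1 1, c := axis 2 1)) :: 'v \<Rightarrow> real ^ 3" and ?r = "(\<lambda>_. 0) :: nat \<Rightarrow> real ^ 3"
    have "spanning_star a B k (\<lambda>v. p v + t *\<^sub>R ?p' v) ?r (n + t *\<^sub>R axis 3 1)"
      if "triple (p b - p a + t *\<^sub>R axis 1 1) (p c - p a + t *\<^sub>R axis 2 1) (n + t *\<^sub>R axis 3 1) \<noteq> 0" for p n t
      unfolding spanning_star_def
    proof (intro allI impI, rule triple_nonzero_imp_orthogonal_zero[OF that])
    qed (use 1 assms(2) in \<open>auto simp: algebra_simps\<close>)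
    then show thesis by (rule that[OF star])
  next
    case 2
    let ?p' = "((\<lambda>_. 0)(b := axis 1 1)) :: 'v \<Rightarrow> real ^ 3" and ?r = "(\<lambda>_. axis 2 1) :: nat \<Rightarrow> real ^ 3"
    have "spanning_star a B k (\<lambda>v. p v + t *\<^sub>R ?p' v) ?r (n + t *\<^sub>R axis 3 1)"
      if "triple (p b - p a + t *\<^sub>R axis 1 1) (0 + t *\<^sub>R axis 2 1) (n + t *\<^sub>R axis 3 1) \<noteq> 0" for p n t
      unfolding spanning_star_def
    proof (intro allI impI, rule triple_nonzero_imp_orthogonal_zero[OF that])
    qed (use 2 assms(2) in \<open>auto simp: algebra_simps\<close>)
    then show thesis by (rule that[OF star])
  next
    case 3
    have two: "{Suc 0..2} = {1, 2}" by auto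
    let ?p' = "(\<lambda>_. 0) :: 'v \<Rightarrow> real ^ 3" and ?r = "(\<lambda>i. if i = 1 then axis 1 1 else axis 2 1) :: nat \<Rightarrow> real ^ 3"
    have "spanning_star a B k (\<lambda>v. p v + t *\<^sub>R ?p' v) ?r (n + t *\<^sub>R axis 3 1)"
      if "triple (0 + t *\<^sub>R axis 1 1) (0 + t *\<^sub>R axis 2 1) (n + t *\<^sub>R axis 3 1) \<noteq> 0" for p n t
      unfolding spanning_star_def
    proof (intro allI impI, rule triple_nonzero_imp_orthogonal_zero[OF that])
    qed (use 3 assms(2) in \<open>auto simp: two algebra_simps\<close>)
    then show thesis by (rule that[OF star])
  qed
qed

text \<open>
  The motions of the old framework vanish, and the three constraints at \<open>v\<close> (two edges or loops and
  the additional loop) then determine the velocity of \<open>v\<close> if they are in general position. The star in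
  question is centred at \<open>v\<close> itself.
\<close>

lemma rigid_add_vertex_degree_2:
  assumes simple: "simple_edges V E" and v: "v \<in> V" "card (nbrs E v) + l v = 2"
    and rigid: "rigid (V - {v}) (remove_vertex v E) l p q"
  shows "\<exists>p q. rigid V E l p q"
proof -
  note N = nbrs_subset[OF simple, of v]
  obtain p' r where
    fin: "\<And>p n. finite {t. \<not> spanning_star v (nbrs E v) (l v) (\<lambda>v. p v + t *\<^sub>R p' v) r (n + t *\<^sub>R axis 3 1)}"
    by (rule spanning_star_generic[OF finite_nbrs[OF simple], of v v "l v"]) (use N v in auto)
  obtain t where
    t: "spanning_star v (nbrs E v) (l v) (\<lambda>w. p w + t *\<^sub>R p' w) r (0 + t *\<^sub>R axis 3 1)"
    and rigid': "rigid (V - {v}) (remove_vertex v E) l (\<lambda>w. p w + t *\<^sub>R p' w) (\<lambda>w i. q w i + t *\<^sub>R 0)"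
    by (rule rigid_generic[OF simple_edges_remove_vertex[OF simple] rigid fin[of p 0], of p' "\<lambda>_ _. 0"]) blast
  define P where "P w = p w + t *\<^sub>R p' w" for w
  define Q where "Q = q(v := \<lambda>i. if i = 0 then t *\<^sub>R axis 3 1 else r i)"
  have "rigid V E l P Q"
  proof (rule rigidI_vertex[OF _ v(1) N])
    fix m assume "motion V E l P Q m"
    then have "motion (V - {v}) (remove_vertex v E) l (\<lambda>w. p w + t *\<^sub>R p' w) (\<lambda>w i. q w i + t *\<^sub>R 0) m"
      by (auto simp: motion_def remove_vertex_def P_def Q_def)
    then show "\<forall>u\<in>V - {v}. m u = 0" using rigid' by (simp add: rigid_def)
  next
    fix y assume y: "\<forall>b\<in>nbrs E v. (P v - P b) \<bullet> y = 0" "\<forall>i\<le>l v. Q v i \<bullet> y = 0"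
    show "y = 0"
    proof (rule t[unfolded spanning_star_def, rule_format])
      show "(0 + t *\<^sub>R axis 3 1) \<bullet> y = 0" using y(2)[rule_format, of 0] by (simp add: Q_def)
      show "((p b + t *\<^sub>R p' b) - (p v + t *\<^sub>R p' v)) \<bullet> y = 0" if "b \<in> nbrs E v" for b
        using y(1) that by (simp add: P_def inner_diff_left)
      show "r i \<bullet> y = 0" if "i \<in> {1..l v}" for i using y(2)[rule_format, of i] that by (simp add: Q_def)
    qed
  qed
  then show ?thesis by blast
qed

text \<open>
  The additional loop at \<open>v\<close> and the edge \<open>va\<close> together simulate a loop at \<open>a\<close>. If \<open>n\<close> is the normal of
  that loop, place \<open>v\<close> at \<open>p a + n\<close> and give its additional loop the normal \<open>n\<close> too. Then
  \<open>n \<bullet> m v = 0\<close> and \<open>n \<bullet> (m v - m a) = 0\<close> yield \<open>n \<bullet> m a = 0\<close>, so every motion restricts to a motion of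
  the smaller framework and vanishes there. The two other constraints at \<open>v\<close> and \<open>n\<close> determine \<open>m v\<close>;
  modulo \<open>n\<close>, the edges at \<open>v\<close> have the same directions as if they were attached to \<open>a\<close>, so the star to be
  put in general position is centred at \<open>a\<close>.
\<close>

lemma rigid_add_vertex_degree_3:
  assumes simple: "simple_edges V E" and v: "v \<in> V" "card (nbrs E v) + l v = 3" and a: "a \<in> nbrs E v"
    and rigid: "rigid (V - {v}) (remove_vertex v E) (l(a := Suc (l a))) p q"
  shows "\<exists>p q. rigid V E l p q"
proof -
  note N = nbrs_subset[OF simple, of v]
  let ?B = "nbrs E v - {a}"
  have "card ?B + 1 = card (nbrs E v)"
    using a finite_nbrs[OF simple] by (metis Suc_eq_plus1 card_Suc_Diff1)
  then have cardB: "card ?B + l v = 2" using v(2) by linarith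
  obtain p' r where
    fin: "\<And>p n. finite {t. \<not> spanning_star a ?B (l v) (\<lambda>v. p v + t *\<^sub>R p' v) r (n + t *\<^sub>R axis 3 1)}"
    by (rule spanning_star_generic[OF _ _ cardB, of a]) (use finite_nbrs[OF simple] in auto)
  define q' where "q' w i = (if w = a \<and> i = Suc (l a) then axis 3 1 else 0 :: real ^ 3)" for w i
  obtain t where
    t: "spanning_star a ?B (l v) (\<lambda>w. p w + t *\<^sub>R p' w) r (q a (Suc (l a)) + t *\<^sub>R axis 3 1)"
    and rigid': "rigid (V - {v}) (remove_vertex v E) (l(a := Suc (l a)))
        (\<lambda>w. p w + t *\<^sub>R p' w) (\<lambda>w i. q w i + t *\<^sub>R q' w i)"
    by (rule rigid_generic[OF simple_edges_remove_vertex[OF simple] rigid fin[of p "q a (Suc (l a))"], of p' q'])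
      blast
  define n where "n = q a (Suc (l a)) + t *\<^sub>R axis 3 1"
  define P where "P = (\<lambda>w. p w + t *\<^sub>R p' w)(v := p a + t *\<^sub>R p' a + n)"
  define Q where "Q = q(v := \<lambda>i. if i = 0 then n else r i)"
  have av: "a \<noteq> v" "a \<in> V" using a N by auto
  have "rigid V E l P Q"
  proof (rule rigidI_vertex[OF _ v(1) N])
    fix m assume m: "motion V E l P Q m"
    have "n \<bullet> m a = 0"
    proof -
      have "{v, a} \<in> E" using a by (simp add: nbrs_def insert_commute)
      then have "(P v - P a) \<bullet> (m v - m a) = 0" using m by (simp add: motion_def)
      moreover have "P v - P a = n" using av by (simp add: P_def)
      moreover have "n \<bullet> m v = 0"
      proof -
        have "Q v 0 \<bullet> m v = 0" using m v(1) by (simp add: motion_def)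
        then show ?thesis by (simp add: Q_def)
      qed
      ultimately show ?thesis by (simp add: inner_diff_right)
    qed
    then have "motion (V - {v}) (remove_vertex v E) (l(a := Suc (l a)))
        (\<lambda>w. p w + t *\<^sub>R p' w) (\<lambda>w i. q w i + t *\<^sub>R q' w i) m"
      unfolding motion_def
    proof (intro conjI allI ballI impI)
      fix u w assume "{u, w} \<in> remove_vertex v E"
      then have "{u, w} \<in> E" "u \<noteq> v" "w \<noteq> v" by (auto simp: remove_vertex_def)
      moreover from this have "(P u - P w) \<bullet> (m u - m w) = 0" using m by (simp add: motion_def)
      ultimately show "((p u + t *\<^sub>R p' u) - (p w + t *\<^sub>R p' w)) \<bullet> (m u - m w) = 0"
        by (simp add: P_def)
    next
      fix w i assume w: "w \<in> V - {v}" and i: "i \<le> (l(a := Suc (l a))) w"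
      show "(q w i + t *\<^sub>R q' w i) \<bullet> m w = 0"
      proof (cases "w = a \<and> i = Suc (l a)")
        case True
        then show ?thesis using \<open>n \<bullet> m a = 0\<close> by (simp add: n_def q'_def)
      next
        case False
        then have "i \<le> l w" using i by (auto split: if_splits)
        then have "Q w i \<bullet> m w = 0" using m w by (simp add: motion_def)
        then show ?thesis using w False by (auto simp: Q_def q'_def)
      qed
    qed
    then show "\<forall>u\<in>V - {v}. m u = 0" using rigid' by (simp add: rigid_def)
  next
    fix y assume y: "\<forall>b\<in>nbrs E v. (P v - P b) \<bullet> y = 0" "\<forall>i\<le>l v. Q v i \<bullet> y = 0"
    have n: "n \<bullet> y = 0" using y(2)[rule_format, of 0] by (simp add: Q_def)
    show "y = 0"
    proof (rule t[unfolded spanning_star_def, rule_format])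
      show "(q a (Suc (l a)) + t *\<^sub>R axis 3 1) \<bullet> y = 0" using n by (simp add: n_def)
      show "((p b + t *\<^sub>R p' b) - (p a + t *\<^sub>R p' a)) \<bullet> y = 0" if b: "b \<in> ?B" for b
      proof -
        have "b \<noteq> v" using N b by auto
        then have "(p b + t *\<^sub>R p' b) - (p a + t *\<^sub>R p' a) = n - (P v - P b)" by (simp add: P_def)
        then show ?thesis using y(1) b n by (auto simp: inner_diff_left)
      qed
      show "r i \<bullet> y = 0" if "i \<in> {1..l v}" for i using y(2)[rule_format, of i] that by (simp add: Q_def)
    qed
  qed
  then show ?thesis by blast
qed

text \<open>
  The vectors \<open>s\<close> and \<open>cross3 \<nu> s\<close> span the plane orthogonal to \<open>\<nu>\<close>, so loops with these normals impose
  the same constraint as any two independent loops with normals in that plane.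
\<close>

lemma orthogonal_frame:
  assumes "\<nu> \<bullet> s = 0" "\<nu> \<noteq> 0" "s \<noteq> 0" and y: "s \<bullet> y = 0" "cross3 \<nu> s \<bullet> y = 0" and n: "\<nu> \<bullet> n = 0"
  shows "n \<bullet> y = 0"
proof -
  define z where "z = y - (\<nu> \<bullet> y / (\<nu> \<bullet> \<nu>)) *\<^sub>R \<nu>"
  have "triple \<nu> s (cross3 \<nu> s) = (\<nu> \<bullet> \<nu>) * (s \<bullet> s) - (\<nu> \<bullet> s)\<^sup>2"
    by (simp add: triple_expand algebra_simps power2_eq_square)
  then have "triple \<nu> s (cross3 \<nu> s) \<noteq> 0" using assms by simp
  moreover have "\<nu> \<bullet> z = 0" using assms(2) by (simp add: z_def inner_diff_right)
  moreover have "s \<bullet> z = 0" using assms(1) y by (simp add: z_def inner_diff_right inner_commute)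
  moreover have "cross3 \<nu> s \<bullet> z = 0" using y by (simp add: z_def inner_diff_right dot_cross_self)
  ultimately have "z = 0" using triple_nonzero_imp_orthogonal_zero by blast
  then have "y = (\<nu> \<bullet> y / (\<nu> \<bullet> \<nu>)) *\<^sub>R \<nu>" by (simp add: z_def)
  then show ?thesis using n by (metis inner_commute inner_scaleR_right mult_zero_right)
qed

text \<open>
  The new vertex replaces both the edge \<open>ab\<close> and one of the two loops at \<open>c\<close>. On the line \<open>ab\<close> its edges
  to \<open>a\<close> and \<open>b\<close> simulate the edge \<open>ab\<close>. As in the case of degree three, its additional loop with normal
  \<open>s\<close>, together with the edge \<open>vc\<close>, simulates a loop at \<open>c\<close> provided that \<open>s = p v - p c\<close>. Only the plane
  spanned by the two normals at \<open>c\<close> matters, and generically the plane through \<open>p c\<close> parallel to it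
  meets the line \<open>ab\<close> in one point; \<open>v\<close> is placed there, so \<open>s\<close> lies in the span of the normals. The
  other normal at \<open>c\<close> is replaced by one that completes \<open>s\<close> to a basis of this span. The edge to the
  fourth neighbour \<open>e\<close> fixes the remaining degree of freedom of \<open>v\<close>.
\<close>

lemma rigid_add_vertex_degree_4:
  assumes simple: "simple_edges V E" and v: "v \<in> V" and N: "nbrs E v = {a, b, c, e}"
    and dist: "distinct [a, b, c, e]" and l: "l v = 0" "l c = 0"
    and rigid: "rigid (V - {v}) (insert {a, b} (remove_vertex v E)) (l(c := Suc (l c))) p q"
  shows "\<exists>p q. rigid V E l p q"
proof -
  have NV: "nbrs E v \<subseteq> V - {v}" by (rule nbrs_subset[OF simple])
  have simple': "simple_edges (V - {v}) (insert {a, b} (remove_vertex v E))"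
    using simple_edges_remove_vertex[OF simple, of v] NV dist by (simp add: simple_edges_def N)
  define p' where "p' = (\<lambda>_. 0)(b := axis 1 1, c := axis 2 1, e := axis 3 1 :: real ^ 3)"
  \<comment> \<open>The cross product of the two directions at \<open>c\<close> is \<open>(1, 2, 0)\<close>, which is orthogonal to none of
    the directions of \<open>b - a\<close>, \<open>c - a\<close> and \<open>c - b\<close>, namely \<open>(1, 0, 0)\<close>, \<open>(0, 1, 0)\<close> and \<open>(-1, 1, 0)\<close>.\<close>
  define q' where "q' w i = (if i = 0 then vector [-2, 1, 0] else axis 3 1 :: real ^ 3)"
    for w :: 'a and i :: nat
  let ?p = "\<lambda>t w. p w + t *\<^sub>R p' w" and ?n = "\<lambda>t i. q c i + t *\<^sub>R q' c i"
  have diff: "?p t u - ?p t w = (p u - p w) + t *\<^sub>R (p' u - p' w)" for t u w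
    by (simp add: algebra_simps)
  have p': "p' a = 0" "p' b = axis 1 1" "p' c = axis 2 1" "p' e = axis 3 1"
    using dist by (auto simp: p'_def)
  define Z where "Z =
      {t. triple (?p t b - ?p t a) (?p t c - ?p t a) (?p t e - ?p t a) = 0}
    \<union> {t. triple (?p t b - ?p t a) (?n t 0) (?n t 1) = 0}
    \<union> {t. triple (?p t c - ?p t a) (?n t 0) (?n t 1) = 0}
    \<union> {t. triple (?p t c - ?p t b) (?n t 0) (?n t 1) = 0}"
  have "finite Z"
    unfolding Z_def diff
    by (intro finite_UnI finite_triple_roots)
      (simp_all add: p' q'_def triple_expand axis_def)
  then obtain t where t: "t \<notin> Z" and rigid': "rigid (V - {v}) (insert {a, b} (remove_vertex v E))
      (l(c := Suc (l c))) (?p t) (\<lambda>w i. q w i + t *\<^sub>R q' w i)"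
    using rigid_generic[OF simple' rigid] by blast
  define D where "D = ?p t b - ?p t a"
  define C where "C = ?p t c - ?p t a"
  define F where "F = ?p t e - ?p t a"
  define \<nu> where "\<nu> = cross3 (?n t 0) (?n t 1)"
  have DCF: "triple D C F \<noteq> 0" using t by (simp add: Z_def D_def C_def F_def)
  have \<nu>D: "\<nu> \<bullet> D \<noteq> 0" and \<nu>C: "\<nu> \<bullet> C \<noteq> 0"
    using t by (simp_all add: Z_def \<nu>_def D_def C_def triple_def inner_commute)
  have \<nu>CD: "\<nu> \<bullet> C \<noteq> \<nu> \<bullet> D"
  proof -
    have "C - D = ?p t c - ?p t b" by (simp add: C_def D_def)
    then have "triple (C - D) (?n t 0) (?n t 1) \<noteq> 0" using t by (simp add: Z_def)
    then have "\<nu> \<bullet> (C - D) \<noteq> 0" by (simp add: triple_def \<nu>_def inner_commute)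
    then show ?thesis by (simp add: inner_diff_right)
  qed
  \<comment> \<open>The point at which the line \<open>ab\<close> meets the plane through \<open>c\<close> orthogonal to \<open>\<nu>\<close>; it differs from
    \<open>a\<close> and \<open>b\<close>, so both edges along the line are nondegenerate.\<close>
  define \<tau> where "\<tau> = (\<nu> \<bullet> C) / (\<nu> \<bullet> D)"
  have \<tau>: "\<tau> \<noteq> 0" "\<tau> \<noteq> 1" using \<nu>D \<nu>C \<nu>CD by (auto simp: \<tau>_def)
  define s where "s = \<tau> *\<^sub>R D - C"
  have \<nu>s: "\<nu> \<bullet> s = 0" using \<nu>D by (simp add: s_def \<tau>_def inner_diff_right)
  have frame: "triple s D (\<tau> *\<^sub>R D - F) = - triple D C F"
    unfolding s_def by (simp add: triple_expand algebra_simps)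
  have s0: "s \<noteq> 0"
  proof
    assume "s = 0"
    then have "triple s D (\<tau> *\<^sub>R D - F) = 0" by (simp add: triple_def)
    then show False using frame DCF by simp
  qed
  have \<nu>0: "\<nu> \<noteq> 0" using \<nu>D by auto
  define P where "P = (?p t)(v := ?p t a + \<tau> *\<^sub>R D)"
  define Q where "Q = (\<lambda>w i. q w i + t *\<^sub>R q' w i)(v := \<lambda>_. s, c := \<lambda>_. cross3 \<nu> s)"
  have ne: "a \<noteq> v" "b \<noteq> v" "c \<noteq> v" "e \<noteq> v" and inV: "c \<in> V" using NV N by auto
  have Pa: "P v - P a = \<tau> *\<^sub>R D" and Pb: "P v - P b = (\<tau> - 1) *\<^sub>R D"
    and Pc: "P v - P c = s" and Pe: "P v - P e = \<tau> *\<^sub>R D - F"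
    using ne by (simp_all add: P_def D_def s_def C_def F_def algebra_simps)
  have "rigid V E l P Q"
  proof (rule rigidI_vertex[OF _ v NV])
    fix m assume m: "motion V E l P Q m"
    have edge: "(P v - P u) \<bullet> (m v - m u) = 0" if "u \<in> {a, b, c, e}" for u
    proof -
      have "{v, u} \<in> E" using that N[symmetric] by (simp add: nbrs_def insert_commute)
      then show ?thesis using m by (simp add: motion_def)
    qed
    have loops: "Q w 0 \<bullet> m w = 0" if "w \<in> V" for w using m that by (simp add: motion_def)
    have "D \<bullet> (m v - m a) = 0" using edge[of a] Pa \<tau> by simp
    moreover have "D \<bullet> (m v - m b) = 0" using edge[of b] Pb \<tau> by simp
    ultimately have ab: "D \<bullet> (m a - m b) = 0" by (simp add: inner_diff_right)
    then have ab': "(?p t a - ?p t b) \<bullet> (m a - m b) = 0" "(?p t b - ?p t a) \<bullet> (m b - m a) = 0"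
      by (simp_all add: D_def inner_diff_left inner_diff_right algebra_simps)
    have "s \<bullet> m v = 0" using loops[OF v] ne by (simp add: Q_def)
    then have "s \<bullet> m c = 0" using edge[of c] Pc by (simp add: inner_diff_right)
    moreover have "cross3 \<nu> s \<bullet> m c = 0" using loops[OF inV] by (simp add: Q_def)
    ultimately have nc: "?n t 0 \<bullet> m c = 0" "?n t 1 \<bullet> m c = 0"
      using orthogonal_frame[OF \<nu>s \<nu>0 s0] by (simp_all add: \<nu>_def dot_cross_self)
    have "motion (V - {v}) (insert {a, b} (remove_vertex v E)) (l(c := Suc (l c)))
      (?p t) (\<lambda>w i. q w i + t *\<^sub>R q' w i) m"
      unfolding motion_def
    proof (intro conjI allI ballI impI)
      fix u w assume "{u, w} \<in> insert {a, b} (remove_vertex v E)"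
      then consider "{u, w} = {a, b}" | "{u, w} \<in> E" "u \<noteq> v" "w \<noteq> v"
        by (auto simp: remove_vertex_def)
      then show "(?p t u - ?p t w) \<bullet> (m u - m w) = 0"
      proof cases
        case 1
        then show ?thesis using ab' by (auto simp: doubleton_eq_iff)
      next
        case 2
        then have "(P u - P w) \<bullet> (m u - m w) = 0" using m by (simp add: motion_def)
        then show ?thesis using 2 by (simp add: P_def)
      qed
    next
      fix w i assume w: "w \<in> V - {v}" and i: "i \<le> (l(c := Suc (l c))) w"
      show "(q w i + t *\<^sub>R q' w i) \<bullet> m w = 0"
      proof (cases "w = c")
        case True
        then have "i = 0 \<or> i = 1" using i l by auto
        then show ?thesis using nc True by auto
      next
        case False
        then have "Q w i \<bullet> m w = 0" using m w i by (simp add: motion_def)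
        then show ?thesis using False w by (simp add: Q_def)
      qed
    qed
    then show "\<forall>u\<in>V - {v}. m u = 0" using rigid' by (simp add: rigid_def)
  next
    fix y assume y: "\<forall>b\<in>nbrs E v. (P v - P b) \<bullet> y = 0" "\<forall>i\<le>l v. Q v i \<bullet> y = 0"
    have "D \<bullet> y = 0" using y(1) N Pa \<tau> by simp
    moreover have "s \<bullet> y = 0" using y(1) N Pc by simp
    moreover have "(\<tau> *\<^sub>R D - F) \<bullet> y = 0" using y(1) N Pe by simp
    ultimately show "y = 0"
      using triple_nonzero_imp_orthogonal_zero[of s D "\<tau> *\<^sub>R D - F" y] frame DCF by simp
  qed
  then show ?thesis by blast
qed

section \<open>Realising tight graphs\<close>

lemma load_insert_edge:
  assumes "finite E" "{a, b} \<notin> E"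
  shows "load (insert {a, b} E) l X = load E l X + (if a \<in> X \<and> b \<in> X then 1 else 0)"
proof -
  have "{e \<in> insert {a, b} E. e \<subseteq> X} =
      (if a \<in> X \<and> b \<in> X then insert {a, b} {e \<in> E. e \<subseteq> X} else {e \<in> E. e \<subseteq> X})" by auto
  then show ?thesis using assms by (simp add: load_def)
qed

lemma tight_remove_degree_2:
  assumes "tight V E l" "v \<in> V" "card (nbrs E v) + l v = 2"
  shows "tight (V - {v}) (remove_vertex v E) l"
proof -
  have "load (remove_vertex v E) l X = load E l X" if "X \<subseteq> V - {v}" for X
    using that by (intro load_remove_vertex) blast
  then show ?thesis
    using assms tight_vertex_load[OF assms(1,2)] simple_edges_remove_vertex[of V E v]
    unfolding tight_def by (auto simp del: card_Diff_insert)
qed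

lemma tight_remove_degree_3:
  assumes tight: "tight V E l" and v: "v \<in> V" "card (nbrs E v) + l v = 3" and a: "a \<in> nbrs E v"
    and slack: "\<And>X. X \<subseteq> V - {v} \<Longrightarrow> a \<in> X \<Longrightarrow> load E l X < 2 * card X"
  shows "tight (V - {v}) (remove_vertex v E) (l(a := Suc (l a)))"
proof -
  have simple: "simple_edges V E" and fin: "finite V"
    using tight by (auto simp: tight_def simple_edges_def)
  have load: "load (remove_vertex v E) (l(a := Suc (l a))) X = load E l X + (if a \<in> X then 1 else 0)"
    if "X \<subseteq> V - {v}" for X
  proof -
    have "finite X" "v \<notin> X" using that fin finite_subset by blast+
    then show ?thesis by (simp add: load_remove_vertex load_add_loop)
  qed
  have "load (remove_vertex v E) (l(a := Suc (l a))) X \<le> 2 * card X" if X: "X \<subseteq> V - {v}" for X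
  proof (cases "a \<in> X")
    case True
    then show ?thesis using slack[OF X] load[OF X] by simp
  next
    case False
    then show ?thesis using tight X load[OF X] by (auto simp: tight_def)
  qed
  moreover have "a \<in> V - {v}" using a nbrs_subset[OF simple] by blast
  ultimately show ?thesis
    using tight_vertex_load[OF tight v(1)] v(2) load[OF order_refl] simple_edges_remove_vertex[OF simple]
    by (simp add: tight_def)
qed

text \<open>
  Each edge inside \<open>X\<close> uses two of the \<open>4 |X|\<close> edge ends at \<open>X\<close>, and each edge from \<open>X\<close> to \<open>v\<close> uses one.
\<close>

lemma regular_load_bound:
  assumes simple: "simple_edges V E" and reg: "\<And>u. u \<in> V \<Longrightarrow> card (nbrs E u) = 4"
    and X: "X \<subseteq> V - {v}"
  shows "2 * card {e \<in> E. e \<subseteq> X} + card (nbrs E v \<inter> X) \<le> 4 * card X"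
proof -
  let ?A = "{e \<in> E. e \<subseteq> X}" and ?B = "(\<lambda>u. {u, v}) ` (nbrs E v \<inter> X)"
  have fin: "finite E" "finite X"
    using simple_edges_finite[OF simple] simple X by (auto simp: simple_edges_def intro: finite_subset)
  have cardB: "card ?B = card (nbrs E v \<inter> X)"
    by (rule card_image) (auto simp: inj_on_def doubleton_eq_iff)
  have "2 * card ?A + card ?B = (\<Sum>e\<in>?A. 2) + (\<Sum>e\<in>?B. 1)" by simp
  also have "\<dots> = (\<Sum>e\<in>?A. card (e \<inter> X)) + (\<Sum>e\<in>?B. card (e \<inter> X))"
  proof (intro arg_cong2[of _ _ _ _ "(+)"] sum.cong refl)
    show "2 = card (e \<inter> X)" if "e \<in> ?A" for e
      using that simple by (auto simp: simple_edges_def Int_absorb2)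
    show "1 = card (e \<inter> X)" if e: "e \<in> ?B" for e
    proof -
      obtain u where "e = {u, v}" "u \<in> X" using e by blast
      moreover have "v \<notin> X" using X by blast
      ultimately have "e \<inter> X = {u}" by blast
      then show ?thesis by simp
    qed
  qed
  also have "\<dots> = (\<Sum>e\<in>?A \<union> ?B. card (e \<inter> X))"
    by (rule sum.union_disjoint[symmetric]) (use fin X in auto)
  also have "\<dots> \<le> (\<Sum>e\<in>E. card (e \<inter> X))"
    by (rule sum_mono2) (use fin in \<open>auto simp: nbrs_def\<close>)
  also have "\<dots> = (\<Sum>u\<in>X. card (nbrs E u))"
    by (rule handshake[OF simple, symmetric]) (use X in blast)
  also have "\<dots> = (\<Sum>u\<in>X. 4)" by (rule sum.cong) (use reg X in auto)
  finally show ?thesis using cardB by simp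
qed

text \<open>
  A set \<open>X\<close> that contains \<open>a\<close> and \<open>b\<close>, or \<open>c\<close>, receives edges from \<open>v\<close>, and \<open>regular_load_bound\<close> turns
  these into slack: one neighbour of \<open>v\<close> in \<open>X\<close> leaves room for one more edge or loop by parity, and
  three leave room for two.
\<close>

lemma tight_remove_degree_4:
  assumes tight: "tight V E l" and reg: "\<And>u. u \<in> V \<Longrightarrow> card (nbrs E u) = 4 \<and> l u = 0"
    and v: "v \<in> V" and N: "nbrs E v = {a, b, c, e}" and dist: "distinct [a, b, c, e]"
    and ab: "{a, b} \<notin> E"
  shows "tight (V - {v}) (insert {a, b} (remove_vertex v E)) (l(c := Suc (l c)))"
proof -
  have simple: "simple_edges V E" and fin: "finite V" "finite (remove_vertex v E)"
    using tight simple_edges_finite[of V E] by (auto simp: tight_def simple_edges_def remove_vertex_def)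
  have NV: "{a, b, c, e} \<subseteq> V - {v}" using nbrs_subset[OF simple, of v] by (simp add: N)
  let ?E = "insert {a, b} (remove_vertex v E)" and ?l = "l(c := Suc (l c))"
  have simple': "simple_edges (V - {v}) ?E"
    using simple_edges_remove_vertex[OF simple, of v] NV dist by (simp add: simple_edges_def)
  have load: "load ?E ?l X = load E l X + (if c \<in> X then 1 else 0) + (if a \<in> X \<and> b \<in> X then 1 else 0)"
    if "X \<subseteq> V - {v}" for X
  proof -
    have "finite X" "v \<notin> X" using that fin finite_subset by blast+
    moreover have "{a, b} \<notin> remove_vertex v E" using ab by (simp add: remove_vertex_def)
    ultimately show ?thesis using fin
      by (simp add: load_insert_edge load_add_loop load_remove_vertex del: fun_upd_apply)
  qed
  have "load ?E ?l X \<le> 2 * card X" if X: "X \<subseteq> V - {v}" for X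
  proof -
    have "sum l X = 0" using reg X by (intro sum.neutral) auto
    then have "2 * load E l X + card (nbrs E v \<inter> X) \<le> 4 * card X"
      using regular_load_bound[OF simple _ X] reg by (simp add: load_def)
    moreover have "load E l X \<le> 2 * card X" using tight X by (auto simp: tight_def)
    moreover have "card (nbrs E v \<inter> X) = (if a \<in> X then 1 else 0) + (if b \<in> X then 1 else 0)
        + (if c \<in> X then 1 else 0) + (if e \<in> X then 1 else 0)"
      using dist by (simp add: N)
    ultimately show ?thesis unfolding load[OF X] by (auto split: if_splits)
  qed
  moreover have "load ?E ?l (V - {v}) = 2 * card (V - {v})"
    using load[OF order_refl] NV tight_vertex_load[OF tight v] reg[OF v] by simp
  ultimately show ?thesis using simple' by (simp add: tight_def)
qed

lemma K5_uses_new_edge: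
  assumes "K5_free E" "a \<noteq> v" "b \<noteq> v" "card X = 5"
    and K: "\<forall>x\<in>X. \<forall>y\<in>X. x \<noteq> y \<longrightarrow> {x, y} \<in> insert {a, b} (remove_vertex v E)"
  shows "a \<in> X" "b \<in> X" "v \<notin> X"
    and "\<And>x y. x \<in> X \<Longrightarrow> y \<in> X \<Longrightarrow> x \<noteq> y \<Longrightarrow> {x, y} \<noteq> {a, b} \<Longrightarrow> {x, y} \<in> E"
proof -
  show E: "\<And>x y. x \<in> X \<Longrightarrow> y \<in> X \<Longrightarrow> x \<noteq> y \<Longrightarrow> {x, y} \<noteq> {a, b} \<Longrightarrow> {x, y} \<in> E"
    using K by (auto simp: remove_vertex_def)
  obtain x y where "x \<in> X" "y \<in> X" "x \<noteq> y" "{x, y} \<notin> E"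
    using assms(1,4) by (auto simp: K5_free_def)
  with E have "{x, y} = {a, b}" by blast
  with \<open>x \<in> X\<close> \<open>y \<in> X\<close> show "a \<in> X" "b \<in> X" by (auto simp: doubleton_eq_iff)
  then show "v \<notin> X" using K assms(2,3) by (auto simp: remove_vertex_def doubleton_eq_iff)
qed

text \<open>
  Since \<open>v\<close> and its neighbours do not form a \<open>K\<^sub>5\<close>, some neighbours \<open>a\<close> and \<open>b\<close> of \<open>v\<close> are not adjacent.
  Suppose that the new edge \<open>ab\<close> completes a \<open>K\<^sub>5\<close> on \<open>X\<close>. Then all edges at the three vertices of
  \<open>X - {a, b}\<close> stay in \<open>X\<close>, and \<open>a\<close> is joined only to these three and to \<open>v\<close>. So a third neighbour \<open>c\<close>
  of \<open>v\<close> lies outside \<open>X\<close> and is not adjacent to \<open>a\<close>, and the edge \<open>ac\<close> completes no \<open>K\<^sub>5\<close>: the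
  remaining vertices of such a \<open>K\<^sub>5\<close> would be neighbours of \<open>a\<close> in \<open>X - {a, b}\<close> adjacent to \<open>c\<close>.
\<close>

lemma regular_nonadjacent_pair:
  assumes simple: "simple_edges V E" and reg: "\<And>u. u \<in> V \<Longrightarrow> card (nbrs E u) = 4"
    and K5: "K5_free E" and v: "v \<in> V"
  obtains a b where "a \<in> nbrs E v" "b \<in> nbrs E v" "a \<noteq> b" "{a, b} \<notin> E"
    "K5_free (insert {a, b} (remove_vertex v E))"
proof -
  note fin = finite_nbrs[OF simple]
  have NV: "nbrs E v \<subseteq> V - {v}" by (rule nbrs_subset[OF simple])
  have "card (insert v (nbrs E v)) = 5" using NV reg[OF v] fin[of v] by (subst card_insert_disjoint) auto
  then obtain a b where ab': "a \<in> insert v (nbrs E v)" "b \<in> insert v (nbrs E v)" "a \<noteq> b" "{a, b} \<notin> E"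
    using K5 unfolding K5_free_def by blast
  then have ab: "a \<in> nbrs E v" "b \<in> nbrs E v" by (auto simp: nbrs_def insert_commute)
  then have abv: "a \<noteq> v" "b \<noteq> v" "a \<in> V" using NV by auto
  show thesis
  proof (cases "K5_free (insert {a, b} (remove_vertex v E))")
    case True
    with ab ab' that show thesis by blast
  next
    case False
    then obtain X where X: "card X = 5"
      and KX: "\<forall>x\<in>X. \<forall>y\<in>X. x \<noteq> y \<longrightarrow> {x, y} \<in> insert {a, b} (remove_vertex v E)"
      unfolding K5_free_def by blast
    note KX' = K5_uses_new_edge[OF K5 abv(1,2) X KX]
    have finX: "finite X" using X card.infinite by fastforce
    have nbrs_y: "nbrs E y = X - {y}" if y: "y \<in> X - {a, b}" for y
    proof (rule card_subset_eq[symmetric, OF fin])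
      show sub: "X - {y} \<subseteq> nbrs E y" using KX'(4) y by (auto simp: nbrs_def doubleton_eq_iff)
      have "a \<in> nbrs E y" using sub KX'(1) y by auto
      then have "y \<in> V" using simple_edgesD[OF simple] by (auto simp: nbrs_def)
      then show "card (X - {y}) = card (nbrs E y)" using reg X finX y by simp
    qed
    have nbrs_a: "insert v (X - {a, b}) = nbrs E a"
    proof (rule card_subset_eq[OF fin])
      show "insert v (X - {a, b}) \<subseteq> nbrs E a"
        using KX'(1,4) ab(1) by (auto simp: nbrs_def doubleton_eq_iff insert_commute)
      have "card (X - {a, b}) = 3"
        using KX'(1,2) ab'(3) X finX by (simp add: card_Diff_subset)
      then show "card (insert v (X - {a, b})) = card (nbrs E a)"
        using reg abv(3) KX'(3) finX by simp
    qed
    have "card (nbrs E v - {a, b}) = 2"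
      using ab ab'(3) reg[OF v] by (simp add: card_Diff_subset)
    then have "nbrs E v - {a, b} \<noteq> {}" by force
    then obtain c where c: "c \<in> nbrs E v" "c \<noteq> a" "c \<noteq> b" by blast
    have cX: "c \<notin> X"
    proof
      assume "c \<in> X"
      then have "nbrs E c = X - {c}" using c nbrs_y by blast
      moreover have "v \<in> nbrs E c" using c(1) by (simp add: nbrs_def insert_commute)
      ultimately show False using KX'(3) by blast
    qed
    have cv: "c \<noteq> v" using c NV by auto
    have ac: "{a, c} \<notin> E"
    proof
      assume "{a, c} \<in> E"
      then have "c \<in> nbrs E a" by (simp add: nbrs_def insert_commute)
      then show False using nbrs_a cX cv by blast
    qed
    have "K5_free (insert {a, c} (remove_vertex v E))"
    proof (rule ccontr)
      assume "\<not> ?thesis"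
      then obtain Y where Y: "card Y = 5"
        and KY: "\<forall>x\<in>Y. \<forall>y\<in>Y. x \<noteq> y \<longrightarrow> {x, y} \<in> insert {a, c} (remove_vertex v E)"
        unfolding K5_free_def by blast
      note KY' = K5_uses_new_edge[OF K5 abv(1) cv Y KY]
      have "\<not> Y \<subseteq> {a, c}" using Y card_mono[of "{a, c}" Y] c(2) by auto
      then obtain y where y: "y \<in> Y" "y \<noteq> a" "y \<noteq> c" by blast
      have "{y, a} \<in> E" "{c, y} \<in> E"
        using KY'(4)[of y a] KY'(4)[of c y] KY'(1,2) y by (auto simp: doubleton_eq_iff)
      then have "y \<in> nbrs E a" "c \<in> nbrs E y" by (auto simp: nbrs_def)
      then have "y \<in> X - {a, b}" using KY'(3) y(1) by (auto simp: nbrs_a[symmetric])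
      then show False using nbrs_y \<open>c \<in> nbrs E y\<close> cX by blast
    qed
    then show thesis using that[of a c] ab(1) c ac by blast
  qed
qed

lemma tight_K5_free_realisable:
  assumes "tight V E l" "K5_free E"
  shows "\<exists>p q. rigid V E l p q"
  using assms
proof (induction "card V" arbitrary: V E l rule: less_induct)
  case less
  note tight = less.prems(1) and K5 = less.prems(2)
  have simple: "simple_edges V E" and fin: "finite V"
    using tight by (auto simp: tight_def simple_edges_def)
  have IH: "\<exists>p q. rigid (V - {v}) E' l' p q"
    if "tight (V - {v}) E' l'" "K5_free E'" "v \<in> V" for v E' l'
    using less.hyps[OF _ that(1,2)] that(3) fin by (meson card_Diff1_less)
  note K5' = K5_free_remove_vertex[OF K5]
  show ?case
  proof (cases "V = {}")
    case True
    then show ?thesis unfolding rigid_def by blast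
  next
    case False
    consider v where "v \<in> V" "card (nbrs E v) + l v = 2" | v where "v \<in> V" "card (nbrs E v) + l v = 3"
      | "\<And>v. v \<in> V \<Longrightarrow> card (nbrs E v) = 4 \<and> l v = 0"
      using tight_low_degree_or_regular[OF tight] tight_min_degree[OF tight]
      by (metis add_2_eq_Suc' le_Suc_eq le_antisym numeral_2_eq_2 numeral_3_eq_3)
    then show ?thesis
    proof cases
      case 1
      then show ?thesis
        using IH[OF tight_remove_degree_2[OF tight 1] K5'] rigid_add_vertex_degree_2[OF simple, of v l] 1 by blast
    next
      case 2
      obtain a where a: "a \<in> nbrs E v"
        and slack: "\<And>X. X \<subseteq> V - {v} \<Longrightarrow> a \<in> X \<Longrightarrow> load E l X < 2 * card X"
        using obtain_loop_vertex[OF tight 2] by blast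
      show ?thesis
        using IH[OF tight_remove_degree_3[OF tight 2 a slack] K5'] 2
          rigid_add_vertex_degree_3[OF simple, of v l a] a by blast
    next
      case 3
      obtain v where v: "v \<in> V" using False by blast
      obtain a b where ab: "a \<in> nbrs E v" "b \<in> nbrs E v" "a \<noteq> b" "{a, b} \<notin> E"
        and K5_new: "K5_free (insert {a, b} (remove_vertex v E))"
        using regular_nonadjacent_pair[OF simple _ K5 v] 3 by blast
      have "card (nbrs E v - {a, b}) = 2"
        using ab 3[OF v] by (simp add: card_Diff_subset)
      then obtain c e where ce: "nbrs E v - {a, b} = {c, e}" "c \<noteq> e" by (meson card_2_iff)
      have N: "nbrs E v = {a, b, c, e}" using ce ab by blast
      have dist: "distinct [a, b, c, e]" using ce ab(3) by auto
      have "c \<in> V" using N nbrs_subset[OF simple, of v] by blast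
      then show ?thesis
        using IH[OF tight_remove_degree_4[OF tight 3 v N dist ab(4)] K5_new v]
          rigid_add_vertex_degree_4[OF simple v N dist] 3 v by blast
    qed
  qed
qed

section \<open>Copies of complete graphs\<close>

lemma contains_complete_graphD:
  assumes "contains_copy H (complete_graph n)"
  shows "\<exists>X\<subseteq>verts H. card X = n \<and>
    (\<forall>u\<in>X. \<forall>v\<in>X. u \<noteq> v \<longrightarrow> (\<exists>e\<in>edges H. ends H e = {u, v}))"
proof -
  obtain K f g where K: "subgraph K H" and f: "bij_betw f (verts K) {..<n}"
    and g: "bij_betw g (edges K) {e. e \<subseteq> {..<n} \<and> card e = 2}"
    and fg: "\<And>e. e \<in> edges K \<Longrightarrow> g e = f ` ends K e"
    using assms unfolding contains_copy_def isomorphic_def complete_graph_def by auto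
  have "\<exists>e\<in>edges H. ends H e = {u, v}" if uv: "u \<in> verts K" "v \<in> verts K" "u \<noteq> v" for u v
  proof -
    have inj: "inj_on f (verts K)" using f by (rule bij_betw_imp_inj_on)
    have "f u \<noteq> f v" using inj uv by (meson inj_onD)
    moreover have "f u < n" "f v < n" using bij_betwE[OF f] uv by auto
    ultimately have "{f u, f v} \<in> {e. e \<subseteq> {..<n} \<and> card e = 2}" by simp
    then have "{f u, f v} \<in> g ` edges K" using g by (simp add: bij_betw_def)
    then obtain e where e: "e \<in> edges K" "f ` ends K e = f ` {u, v}" using fg by auto
    moreover have "ends K e \<subseteq> verts K" using K e(1) unfolding subgraph_def is_graph_def by blast
    ultimately have "ends K e = {u, v}" using inj_on_image_eq_iff[OF inj, of "ends K e" "{u, v}"] uv by simp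
    then show ?thesis using K e(1) unfolding subgraph_def by (intro bexI[of _ e]) auto
  qed
  moreover have "card (verts K) = n" using bij_betw_same_card[OF f] by simp
  moreover have "verts K \<subseteq> verts H" using K by (simp add: subgraph_def)
  ultimately show ?thesis by blast
qed

lemma contains_complete_graphI:
  assumes H: "looped_simple H" and X: "X \<subseteq> verts H" "card X = n"
    and all: "\<And>u v. u \<in> X \<Longrightarrow> v \<in> X \<Longrightarrow> u \<noteq> v \<Longrightarrow> {u, v} \<in> ends H ` edges H"
  shows "contains_copy H (complete_graph n)"
proof -
  have G: "is_graph H" and inj: "inj_on (ends H) (edges H)" using H by (auto simp: looped_simple_def)
  have finX: "finite X" using G X(1) finite_subset by (auto simp: is_graph_def)
  define K where "K = \<lparr>verts = X, edges = {e \<in> edges H. ends H e \<subseteq> X}, loops = {}, ends = ends H\<rparr>"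
  have K: "subgraph K H" using G X(1) finX by (auto simp: K_def subgraph_def is_graph_def)
  obtain f where f: "bij_betw f X {..<n}"
    using ex_bij_betw_finite_nat[OF finX] X(2) by (auto simp: atLeast0LessThan)
  have injf: "inj_on f X" using f by (rule bij_betw_imp_inj_on)
  have "bij_betw (\<lambda>e. f ` ends H e) (edges K) {e. e \<subseteq> {..<n} \<and> card e = 2}"
    unfolding bij_betw_def
  proof (intro conjI equalityI subsetI)
    show "inj_on (\<lambda>e. f ` ends H e) (edges K)"
    proof (rule inj_onI)
      fix d e assume "d \<in> edges K" "e \<in> edges K" "f ` ends H d = f ` ends H e"
      then have "ends H d = ends H e" using inj_on_image_eq_iff[OF injf] by (simp add: K_def)
      then show "d = e" using inj \<open>d \<in> edges K\<close> \<open>e \<in> edges K\<close> by (auto simp: K_def dest: inj_onD)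
    qed
  next
    fix s assume "s \<in> (\<lambda>e. f ` ends H e) ` edges K"
    then obtain e where e: "e \<in> edges H" "ends H e \<subseteq> X" "s = f ` ends H e" by (auto simp: K_def)
    have "card s = card (ends H e)" unfolding e by (rule card_image) (rule inj_on_subset[OF injf e(2)])
    then show "s \<in> {e. e \<subseteq> {..<n} \<and> card e = 2}"
      using e G bij_betw_imp_surj_on[OF f] by (auto simp: is_graph_def)
  next
    fix s assume s: "s \<in> {e. e \<subseteq> {..<n} \<and> card e = 2}"
    then obtain i j where ij: "s = {i, j}" "i \<noteq> j" by (auto simp: card_2_iff)
    then have "i \<in> f ` X" "j \<in> f ` X" using s bij_betw_imp_surj_on[OF f] by auto
    then obtain u v where uv: "u \<in> X" "v \<in> X" "i = f u" "j = f v" by blast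
    then obtain e where "e \<in> edges H" "ends H e = {u, v}" using all[of u v] ij by auto
    then show "s \<in> (\<lambda>e. f ` ends H e) ` edges K" using uv ij by (auto simp: K_def intro!: image_eqI[of _ _ e])
  qed
  then have "isomorphic K (complete_graph n)"
    using f unfolding isomorphic_def
    by (intro exI[of _ f] exI[of _ "\<lambda>e. f ` ends H e"]) (auto simp: K_def complete_graph_def bij_betw_def)
  with K show ?thesis by (auto simp: contains_copy_def)
qed

section \<open>Necessity\<close>

text \<open>
  An affine dependence \<open>\<omega>\<close> of points gives the equilibrium stress \<open>\<omega> u * \<omega> v\<close> on the complete graph:
  the forces at \<open>u\<close> add up to \<open>\<omega> u\<close> times \<open>(\<Sum>v. \<omega> v) p u - \<Sum>v. \<omega> v p v = 0\<close>.
\<close>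

lemma affine_dependence_stress:
  fixes p m :: "'v \<Rightarrow> 'a::real_inner"
  assumes "(\<Sum>u\<in>X. \<omega> u) = 0" "(\<Sum>u\<in>X. \<omega> u *\<^sub>R p u) = 0"
  shows "(\<Sum>u\<in>X. \<Sum>v\<in>X. \<omega> u * \<omega> v * ((p u - p v) \<bullet> (m u - m v))) = 0"
proof -
  define M where "M = (\<Sum>v\<in>X. \<omega> v *\<^sub>R m v)"
  define S where "S = (\<Sum>v\<in>X. \<omega> v * (p v \<bullet> m v))"
  have "(\<Sum>v\<in>X. \<omega> u * \<omega> v * ((p u - p v) \<bullet> (m u - m v))) = \<omega> u * (S - p u \<bullet> M)" for u
  proof -
    have "(\<Sum>v\<in>X. \<omega> u * \<omega> v * ((p u - p v) \<bullet> (m u - m v)))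
        = \<omega> u * (\<Sum>v\<in>X. \<omega> v * (p u \<bullet> m u) - p u \<bullet> (\<omega> v *\<^sub>R m v) - (\<omega> v *\<^sub>R p v) \<bullet> m u + \<omega> v * (p v \<bullet> m v))"
      unfolding sum_distrib_left by (rule sum.cong) (auto simp: algebra_simps inner_simps)
    also have "\<dots> = \<omega> u * ((\<Sum>v\<in>X. \<omega> v) * (p u \<bullet> m u) - p u \<bullet> M - (\<Sum>v\<in>X. \<omega> v *\<^sub>R p v) \<bullet> m u + S)"
      by (simp add: sum.distrib sum_subtractf sum_distrib_right inner_sum_left inner_sum_right M_def S_def)
    finally show ?thesis by (simp add: assms)
  qed
  then have "(\<Sum>u\<in>X. \<Sum>v\<in>X. \<omega> u * \<omega> v * ((p u - p v) \<bullet> (m u - m v))) = (\<Sum>u\<in>X. \<omega> u * (S - p u \<bullet> M))"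
    by simp
  also have "\<dots> = (\<Sum>u\<in>X. \<omega> u) * S - (\<Sum>u\<in>X. \<omega> u *\<^sub>R p u) \<bullet> M"
    by (simp add: algebra_simps sum_subtractf sum_distrib_left inner_sum_left)
  finally show ?thesis by (simp add: assms)
qed

lemma five_points_affinely_dependent:
  fixes p :: "'v \<Rightarrow> real ^ 3"
  assumes "card X = 5"
  obtains \<omega> u v where "(\<Sum>u\<in>X. \<omega> u) = 0" "(\<Sum>u\<in>X. \<omega> u *\<^sub>R p u) = 0"
    "u \<in> X" "v \<in> X" "u \<noteq> v" "\<omega> u \<noteq> 0" "\<omega> v \<noteq> 0"
proof -
  have fin: "finite X" using assms card.infinite by fastforce
  have "\<exists>\<omega>. (\<exists>u\<in>X. \<omega> u \<noteq> 0) \<and>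
      (\<forall>j\<in>(UNIV :: 3 option set). (\<Sum>u\<in>X. (case j of None \<Rightarrow> 1 | Some k \<Rightarrow> p u $ k) * \<omega> u) = 0)"
    by (rule underdetermined_system) (use fin assms in \<open>simp_all add: card_UNIV_option\<close>)
  then obtain \<omega> u where \<omega>: "u \<in> X" "\<omega> u \<noteq> 0"
    and eq: "\<And>j :: 3 option. (\<Sum>u\<in>X. (case j of None \<Rightarrow> 1 | Some k \<Rightarrow> p u $ k) * \<omega> u) = 0" by auto
  have sum0: "(\<Sum>u\<in>X. \<omega> u) = 0" using eq[of None] by simp
  have "(\<Sum>u\<in>X. \<omega> u *\<^sub>R p u) = 0"
    using eq[of "Some _"] by (simp add: vec_eq_iff mult.commute)
  moreover have "\<exists>v\<in>X - {u}. \<omega> v \<noteq> 0"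
  proof (rule ccontr)
    assume "\<not> ?thesis"
    then have "(\<Sum>u\<in>X. \<omega> u) = \<omega> u" using fin \<omega>(1) by (simp add: sum.remove)
    with sum0 \<omega>(2) show False by simp
  qed
  ultimately show thesis using that[OF sum0] \<omega> by blast
qed

text \<open>
  The edges and loops of the subgraph are a minimal set \<open>F\<close> that forces the velocities to vanish once
  each velocity is confined to the plane of its additional loop. Fewer than \<open>2 |V|\<close> of them cannot
  suffice. Conversely, the dual motions \<open>d f\<close> of the members of \<open>F'\<close> are independent on the vertices
  incident to \<open>F'\<close>, where each vertex contributes only a plane; this is sparsity. Parallel edges have
  proportional rows, and the rows of a \<open>K\<^sub>5\<close> are dependent; both contradict the existence of dual motions.
\<close>

lemma rigid_imp_tight_K5_free_subgraph:
  fixes G :: "('v, 'e) graph" and p :: "'v \<Rightarrow> real ^ 3"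
  assumes G: "is_graph G" and rigid: "infinitesimally_rigid (add_loop_everywhere G) p q"
  shows "\<exists>H. spanning_subgraph H G \<and> looped_simple H \<and> tight_2_0 H \<and>
             \<not> contains_copy H (complete_graph 5)"
proof -
  let ?V = "verts G"
  have fin: "finite ?V" "finite (edges G)" "finite (loops G)"
    and ends_V: "\<And>e. e \<in> edges G \<union> loops G \<Longrightarrow> ends G e \<subseteq> ?V"
    and disjoint: "edges G \<inter> loops G = {}"
    using G by (auto simp: is_graph_def)
  have "\<forall>e\<in>edges G. \<exists>u v. ends G e = {u, v}" using G unfolding is_graph_def card_2_iff by metis
  then obtain tail head where th: "\<And>e. e \<in> edges G \<Longrightarrow> ends G e = {tail e, head e}" by metis
  have "\<forall>e\<in>loops G. \<exists>v. ends G e = {v}"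
    using G unfolding is_graph_def by (metis card_1_singletonE)
  then obtain base where base: "\<And>e. e \<in> loops G \<Longrightarrow> ends G e = {base e}" by metis
  \<comment> \<open>A zero normal may be replaced by any other vector: this only adds a constraint, and it makes
    every velocity lie in a plane.\<close>
  define n where "n v = (if q (Inr v) = 0 then axis 1 1 else q (Inr v))" for v
  have n0: "n v \<noteq> 0" for v by (simp add: n_def axis_eq_0_iff)
  define P where "P m \<longleftrightarrow> (\<forall>v\<in>?V. n v \<bullet> m v = 0)" for m :: "'v \<Rightarrow> real ^ 3"
  define row where "row e m = (if e \<in> edges G then (p (tail e) - p (head e)) \<bullet> (m (tail e) - m (head e))
      else q (Inl e) \<bullet> m (base e))" for e m
  have row_edge: "row e m = (p u - p v) \<bullet> (m u - m v)" if "e \<in> edges G" "ends G e = {u, v}" for e u v m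
  proof -
    have "u = tail e \<and> v = head e \<or> u = head e \<and> v = tail e"
      using that th[OF that(1)] by (auto simp: doubleton_eq_iff)
    then show ?thesis using that(1)
      by (auto simp: row_def inner_diff_left inner_diff_right algebra_simps)
  qed
  have row_linear: "linear_functional (row e)" for e
    unfolding linear_functional_def row_def by (auto simp: algebra_simps inner_simps)
  have kernel: "\<forall>v\<in>?V. m v = 0" if "P m" "\<forall>e\<in>edges G \<union> loops G. row e m = 0" for m
  proof -
    have "infinitesimal_motion (add_loop_everywhere G) p q m"
      unfolding infinitesimal_motion_def
    proof (intro conjI ballI allI impI)
      fix e u v assume "e \<in> edges (add_loop_everywhere G)" "ends (add_loop_everywhere G) e = {u, v}"
      then obtain e' where "e' \<in> edges G" "ends G e' = {u, v}" by (auto simp: add_loop_everywhere_def)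
      then show "(p u - p v) \<bullet> (m u - m v) = 0" using that(2) row_edge[of e' u v m] by auto
    next
      fix e v assume e: "e \<in> loops (add_loop_everywhere G)" "ends (add_loop_everywhere G) e = {v}"
      then consider e' where "e = Inl e'" "e' \<in> loops G" "ends G e' = {v}" | "e = Inr v" "v \<in> ?V"
        by (auto simp: add_loop_everywhere_def)
      then show "q e \<bullet> m v = 0"
      proof cases
        case 1
        then have "base e' = v" "e' \<notin> edges G" using base[of e'] disjoint by auto
        moreover have "row e' m = 0" using that(2) 1(2) by blast
        ultimately show ?thesis using 1(1) by (simp add: row_def)
      next
        case 2
        then have "n v \<bullet> m v = 0" using that(1) by (simp add: P_def)
        then show ?thesis using 2 by (cases "q (Inr v) = 0") (simp_all add: n_def)
      qed
    qed
    then show ?thesis using rigid by (simp add: infinitesimally_rigid_def add_loop_everywhere_def)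
  qed
  obtain F d where F: "F \<subseteq> edges G \<union> loops G"
    and kerF: "\<And>m. P m \<Longrightarrow> \<forall>e\<in>F. row e m = 0 \<Longrightarrow> \<forall>v\<in>?V. m v = 0"
    and d: "\<And>e. e \<in> F \<Longrightarrow> P (d e) \<and> \<not> (\<forall>v\<in>?V. d e v = 0) \<and> (\<forall>f\<in>F - {e}. row f (d e) = 0)"
    by (rule minimal_determining_subfamily[of "edges G \<union> loops G" P row ?V]) (use fin kernel in auto)
  have finF: "finite F" using F fin finite_subset by blast
  have d1: "row e (d e) \<noteq> 0" if "e \<in> F" for e using kerF[of "d e"] d[OF that] by auto
  have d0: "row f (d e) = 0" if "e \<in> F" "f \<in> F" "f \<noteq> e" for e f using d that by auto

  have sparse: "card F' \<le> 2 * card (incident_verts G F')" if F': "F' \<subseteq> F" for F'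
  proof (rule ccontr)
    let ?X = "incident_verts G F'"
    assume "\<not> ?thesis"
    moreover have XV: "?X \<subseteq> ?V" using F' F ends_V by (force simp: incident_verts_def)
    have finX: "finite ?X" using XV fin finite_subset by blast
    have "\<forall>v. \<exists>y z. triple (n v) y z \<noteq> 0" using nonzero_extends_to_triple n0 by blast
    then obtain y z where yz: "\<And>v. triple (n v) (y v) (z v) \<noteq> 0" by metis
    have "card (?X \<times> (UNIV :: bool set)) = 2 * card ?X" by (simp add: card_cartesian_product)
    moreover have "finite F'" using F' finF finite_subset by blast
    ultimately have "\<exists>c. (\<exists>f\<in>F'. c f \<noteq> 0) \<and> (\<forall>j\<in>?X \<times> (UNIV :: bool set).
        (\<Sum>f\<in>F'. ((if snd j then y (fst j) else z (fst j)) \<bullet> d f (fst j)) * c f) = 0)"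
      by (intro underdetermined_system) (use finX in auto)
    then obtain c g where g: "g \<in> F'" "c g \<noteq> 0"
      and c': "\<forall>j\<in>?X \<times> (UNIV :: bool set).
        (\<Sum>f\<in>F'. ((if snd j then y (fst j) else z (fst j)) \<bullet> d f (fst j)) * c f) = 0" by blast
    have c: "(\<Sum>f\<in>F'. ((if b then y v else z v) \<bullet> d f v) * c f) = 0" if "v \<in> ?X" for v b
      using bspec[OF c', of "(v, b)"] that by (cases b) simp_all
    \<comment> \<open>A nontrivial combination of dual motions that vanishes on \<open>?X\<close>, although the row of \<open>g\<close> detects it.\<close>
    define h where "h v = (\<Sum>f\<in>F'. c f *\<^sub>R d f v)" for v
    have h0: "h v = 0" if v: "v \<in> ?X" for v
    proof (rule triple_nonzero_imp_orthogonal_zero[OF yz[of v]])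
      have "n v \<bullet> d f v = 0" if "f \<in> F'" for f using d[of f] that F' v XV by (auto simp: P_def)
      then show "n v \<bullet> h v = 0" by (simp add: h_def inner_sum_right)
      show "y v \<bullet> h v = 0" using c[OF v, of True] by (simp add: h_def inner_sum_right mult.commute)
      show "z v \<bullet> h v = 0" using c[OF v, of False] by (simp add: h_def inner_sum_right mult.commute)
    qed
    have "row g h = (\<Sum>f\<in>F'. c f * row g (d f))"
      unfolding h_def by (rule linear_functional_sum[OF row_linear \<open>finite F'\<close>])
    also have "\<dots> = (\<Sum>f\<in>F'. if f = g then c g * row g (d g) else 0)"
      by (rule sum.cong) (use d0 F' g in auto)
    also have "\<dots> = c g * row g (d g)" using g \<open>finite F'\<close> by simp
    also have "\<dots> \<noteq> 0" using g d1 F' by auto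
    finally have "row g h \<noteq> 0" .
    moreover have gX: "ends G g \<subseteq> ?X" using g by (auto simp: incident_verts_def)
    have "row g h = 0"
    proof (cases "g \<in> edges G")
      case True
      then show ?thesis using gX th[of g] h0 by (simp add: row_def)
    next
      case False
      then have "g \<in> loops G" using g F F' by blast
      then show ?thesis using False gX base[of g] h0 by (simp add: row_def)
    qed
    ultimately show False by simp
  qed

  have large: "2 * card ?V \<le> card F"
  proof (rule ccontr)
    assume small: "\<not> ?thesis"
    \<comment> \<open>If the bound fails, there are fewer than \<open>3 |V|\<close> equations for the coordinates of the velocities.\<close>
    define unit where "unit i x = (if x = fst i then axis (snd i) 1 else 0 :: real ^ 3)" for i :: "'v \<times> 3" and x
    define A where "A j i = (case j of Inl e \<Rightarrow> row e (unit i) | Inr v \<Rightarrow> n v \<bullet> unit i v)" for j i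
    let ?I = "?V \<times> (UNIV :: 3 set)"
    have "card (F <+> ?V) < card ?I"
      using small fin finF by (simp add: card_Plus card_cartesian_product)
    then have "\<exists>c. (\<exists>i\<in>?I. c i \<noteq> 0) \<and> (\<forall>j\<in>F <+> ?V. (\<Sum>i\<in>?I. A j i * c i) = 0)"
      by (intro underdetermined_system) (use fin finF in auto)
    then obtain c v k where c: "v \<in> ?V" "c (v, k) \<noteq> 0"
      and eq: "\<forall>j\<in>F <+> ?V. (\<Sum>i\<in>?I. A j i * c i) = 0" by blast
    define m where "m x = (\<Sum>i\<in>?I. c i *\<^sub>R unit i x)" for x
    have "finite ?I" using fin by simp
    have "row e m = 0" if "e \<in> F" for e
      using bspec[OF eq, of "Inl e"] that linear_functional_sum[OF row_linear \<open>finite ?I\<close>, of e c unit]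
      by (simp add: A_def m_def[abs_def] mult.commute InlI)
    moreover have "P m"
      unfolding P_def
    proof
      fix w assume "w \<in> ?V"
      then show "n w \<bullet> m w = 0"
        using bspec[OF eq, of "Inr w"] by (simp add: InrI A_def m_def inner_sum_right mult.commute)
    qed
    ultimately have "m v = 0" using kerF[of m] c(1) by blast
    have "m v $ k = (\<Sum>i\<in>?I. if i = (v, k) then c i else 0)"
      unfolding m_def sum_component by (rule sum.cong) (auto simp: unit_def axis_def)
    also have "\<dots> = c (v, k)" using c(1) \<open>finite ?I\<close> by simp
    finally show False using c(2) \<open>m v = 0\<close> by simp
  qed

  define H where "H = \<lparr>verts = ?V, edges = edges G \<inter> F, loops = loops G \<inter> F, ends = ends G\<rparr>"
  have H: "verts H = ?V" "edges H = edges G \<inter> F" "loops H = loops G \<inter> F" "ends H = ends G"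
    by (simp_all add: H_def)
  have graph: "is_graph H" using G by (auto simp: H is_graph_def)
  have "spanning_subgraph H G"
    using graph by (auto simp: H spanning_subgraph_def subgraph_def)
  moreover have "looped_simple H"
    unfolding looped_simple_def
  proof (intro conjI graph inj_onI)
    fix e f assume ef: "e \<in> edges H" "f \<in> edges H" "ends H e = ends H f"
    show "e = f"
    proof (rule ccontr)
      assume "e \<noteq> f"
      have "row e (d e) = row f (d e)"
        using ef th[of f] row_edge[of e "tail f" "head f"] row_edge[of f "tail f" "head f"] by (simp add: H)
      then show False using ef d0[of e f] d1[of e] \<open>e \<noteq> f\<close> by (simp add: H)
    qed
  qed
  moreover have "tight_2_0 H"
    unfolding tight_2_0_def sparse_2_0_def
  proof (intro conjI allI impI)
    fix F' assume "F' \<noteq> {} \<and> F' \<subseteq> edges H \<union> loops H"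
    then show "card F' \<le> 2 * card (incident_verts H F')"
      using sparse[of F'] by (auto simp: H incident_verts_def)
  next
    have "incident_verts G F \<subseteq> ?V" using F ends_V by (force simp: incident_verts_def)
    then have "card (incident_verts G F) \<le> card ?V" by (rule card_mono[OF fin(1)])
    then have "card F = 2 * card ?V" using sparse[OF order_refl] large by linarith
    moreover have "card F = card (edges G \<inter> F) + card (loops G \<inter> F)"
    proof -
      have "F = (edges G \<inter> F) \<union> (loops G \<inter> F)" using F by blast
      then show ?thesis using disjoint finF by (subst card_Un_disjoint[symmetric]) auto
    qed
    ultimately show "card (edges H) + card (loops H) = 2 * card (verts H)" by (simp add: H)
  qed
  moreover have "\<not> contains_copy H (complete_graph 5)"
  proof
    assume "contains_copy H (complete_graph 5)"
    then obtain X where X: "card X = 5"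
      and K5: "\<And>u v. u \<in> X \<Longrightarrow> v \<in> X \<Longrightarrow> u \<noteq> v \<Longrightarrow> \<exists>e\<in>edges G \<inter> F. ends G e = {u, v}"
      using contains_complete_graphD[of H 5] by (auto simp: H)
    obtain \<omega> a b where \<omega>: "(\<Sum>u\<in>X. \<omega> u) = 0" "(\<Sum>u\<in>X. \<omega> u *\<^sub>R p u) = 0"
      and ab: "a \<in> X" "b \<in> X" "a \<noteq> b" "\<omega> a \<noteq> 0" "\<omega> b \<noteq> 0"
      by (rule five_points_affinely_dependent[OF X, of p])
    obtain g where g: "g \<in> edges G \<inter> F" "ends G g = {a, b}" using K5 ab by blast
    \<comment> \<open>All rows of the \<open>K\<^sub>5\<close> except that of \<open>g\<close> vanish on \<open>d g\<close>, so the stress leaves only the term of \<open>g\<close>.\<close>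
    let ?s = "\<lambda>(u, v). \<omega> u * \<omega> v * ((p u - p v) \<bullet> (d g u - d g v))"
    have finX: "finite X" using X card.infinite by fastforce
    have "0 = (\<Sum>z\<in>X \<times> X. ?s z)"
      using affine_dependence_stress[OF \<omega>, of "d g"] by (simp add: sum.cartesian_product)
    also have "\<dots> = (\<Sum>z\<in>{(a, b), (b, a)}. ?s z)"
    proof (rule sum.mono_neutral_right)
      show "\<forall>z\<in>X \<times> X - {(a, b), (b, a)}. ?s z = 0"
      proof
        fix z assume "z \<in> X \<times> X - {(a, b), (b, a)}"
        then obtain u v where z: "z = (u, v)" "u \<in> X" "v \<in> X" "{u, v} \<noteq> {a, b}"
          by (cases z) (auto simp: doubleton_eq_iff)
        show "?s z = 0"
        proof (cases "u = v")
          case False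
          then obtain e where e: "e \<in> edges G \<inter> F" "ends G e = {u, v}" using K5 z by blast
          then have "e \<noteq> g" using z(4) g(2) by auto
          then have "row e (d g) = 0" using e g d0 by blast
          then show ?thesis using row_edge[of e u v "d g"] e z(1) by simp
        qed (simp add: z(1))
      qed
    qed (use finX ab in auto)
    also have "\<dots> = 2 * (\<omega> a * \<omega> b * row g (d g))"
      using ab(3) row_edge[of g a b "d g"] row_edge[of g b a "d g"] g by (simp add: insert_commute)
    finally show False using ab d1 g by simp
  qed
  ultimately show ?thesis by blast
qed

section \<open>The characterisation\<close>

lemma tight_K5_free_subgraph_imp_rigid:
  fixes G :: "('v, 'e) graph"
  assumes sub: "spanning_subgraph H G" and simple: "looped_simple H" and tight: "tight_2_0 H"
    and K5: "\<not> contains_copy H (complete_graph 5)"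
  shows "\<exists>(p :: 'v \<Rightarrow> real ^ 3) (q :: 'e + 'v \<Rightarrow> real ^ 3).
           infinitesimally_rigid (add_loop_everywhere G) p q"
proof -
  define V where "V = verts H"
  define E where "E = ends H ` edges H"
  define L where "L v = {x \<in> loops H. ends H x = {v}}" for v
  define l where "l v = card (L v)" for v
  have graph: "is_graph H" and inj: "inj_on (ends H) (edges H)" using simple by (auto simp: looped_simple_def)
  have fin: "finite V" "finite (edges H)" "finite (loops H)" and disjoint: "edges H \<inter> loops H = {}"
    using graph by (auto simp: V_def is_graph_def)
  have finL: "finite (L v)" for v using fin by (simp add: L_def)
  have load: "load E l X = card {e \<in> edges H \<union> loops H. ends H e \<subseteq> X}" if X: "X \<subseteq> V" for X
  proof -
    have "{e \<in> E. e \<subseteq> X} = ends H ` {e \<in> edges H. ends H e \<subseteq> X}" by (auto simp: E_def)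
    moreover have "inj_on (ends H) {e \<in> edges H. ends H e \<subseteq> X}" by (rule inj_on_subset[OF inj]) auto
    ultimately have 1: "card {e \<in> E. e \<subseteq> X} = card {e \<in> edges H. ends H e \<subseteq> X}" by (simp add: card_image)
    have "sum l X = card (\<Union>v\<in>X. L v)"
      unfolding l_def using finL finite_subset[OF X fin(1)]
      by (subst card_UN_disjoint) (auto simp: L_def)
    also have "(\<Union>v\<in>X. L v) = {x \<in> loops H. ends H x \<subseteq> X}"
      using graph by (auto simp: L_def is_graph_def card_1_singleton_iff)
    finally have 2: "sum l X = card {x \<in> loops H. ends H x \<subseteq> X}" .
    have "{e \<in> edges H \<union> loops H. ends H e \<subseteq> X} =
        {e \<in> edges H. ends H e \<subseteq> X} \<union> {x \<in> loops H. ends H x \<subseteq> X}" by auto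
    then show ?thesis using 1 2 fin disjoint
      by (simp add: load_def) (subst card_Un_disjoint; auto)
  qed
  have sparse: "card F \<le> 2 * card (incident_verts H F)"
    if "F \<noteq> {}" "F \<subseteq> edges H \<union> loops H" for F
    using tight that by (simp add: tight_2_0_def sparse_2_0_def)
  have "tight V E l"
    unfolding tight_def
  proof (intro conjI allI impI)
    show "simple_edges V E" using graph by (auto simp: simple_edges_def V_def E_def is_graph_def)
    show "load E l X \<le> 2 * card X" if X: "X \<subseteq> V" for X
    proof (cases "{e \<in> edges H \<union> loops H. ends H e \<subseteq> X} = {}")
      case True
      show ?thesis unfolding load[OF X] True by simp
    next
      case False
      let ?F = "{e \<in> edges H \<union> loops H. ends H e \<subseteq> X}"
      have "card ?F \<le> 2 * card (incident_verts H ?F)"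
        by (rule sparse[OF False]) auto
      moreover have "card (incident_verts H ?F) \<le> card X"
        by (rule card_mono[OF finite_subset[OF X fin(1)]]) (auto simp: incident_verts_def)
      ultimately show ?thesis using load[OF X] by linarith
    qed
    have "{e \<in> edges H \<union> loops H. ends H e \<subseteq> V} = edges H \<union> loops H"
      using graph by (auto simp: V_def is_graph_def)
    then show "load E l V = 2 * card V"
      using load[OF order_refl] tight fin disjoint
      by (simp add: card_Un_disjoint tight_2_0_def V_def)
  qed
  moreover have "K5_free E"
    unfolding K5_free_def
  proof (intro allI impI, rule ccontr)
    fix X :: "'v set" assume X: "card X = 5" and "\<not> (\<exists>u\<in>X. \<exists>v\<in>X. u \<noteq> v \<and> {u, v} \<notin> E)"
    then have all: "\<And>u v. u \<in> X \<Longrightarrow> v \<in> X \<Longrightarrow> u \<noteq> v \<Longrightarrow> {u, v} \<in> ends H ` edges H"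
      unfolding E_def by blast
    have "X \<subseteq> verts H"
    proof
      fix u assume u: "u \<in> X"
      have "\<not> X \<subseteq> {u}" using X card_mono[of "{u}" X] by auto
      then obtain v where "v \<in> X" "u \<noteq> v" by blast
      then obtain e where e: "e \<in> edges H" "{u, v} = ends H e" using all[OF u] by blast
      moreover have "ends H e \<subseteq> verts H" using e(1) graph by (simp add: is_graph_def)
      ultimately show "u \<in> verts H" by blast
    qed
    then show False using contains_complete_graphI[OF simple _ X all] K5 by blast
  qed
  ultimately obtain p q where rigid: "rigid V E l p q" using tight_K5_free_realisable by blast
  \<comment> \<open>The loops of \<open>H\<close> at \<open>v\<close> take over the normals numbered \<open>1, \<dots>, l v\<close>.\<close>
  have "\<forall>v. \<exists>h. bij_betw h (L v) {1..l v}"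
    using finL by (auto simp: l_def bij_betw_iff_card)
  then obtain h where h: "\<And>v. bij_betw (h v) (L v) {1..l v}" by metis
  define Q where "Q = case_sum (\<lambda>x. q (the_elem (ends H x)) (h (the_elem (ends H x)) x)) (\<lambda>v. q v 0)"
  have subH: "edges H \<subseteq> edges G" "loops H \<subseteq> loops G" "V = verts G"
    "\<And>e. e \<in> edges H \<union> loops H \<Longrightarrow> ends H e = ends G e"
    using sub by (auto simp: spanning_subgraph_def subgraph_def V_def)
  have "infinitesimally_rigid (add_loop_everywhere G) p Q"
    unfolding infinitesimally_rigid_def
  proof (intro allI impI)
    fix m assume m: "infinitesimal_motion (add_loop_everywhere G) p Q m"
    have edge: "(p u - p v) \<bullet> (m u - m v) = 0" if "e \<in> edges G" "ends G e = {u, v}" for e u v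
    proof -
      have "Inl e \<in> edges (add_loop_everywhere G)" "ends (add_loop_everywhere G) (Inl e) = {u, v}"
        using that by (auto simp: add_loop_everywhere_def)
      then show ?thesis using m unfolding infinitesimal_motion_def by blast
    qed
    have loop: "Q x \<bullet> m v = 0" if "x \<in> loops (add_loop_everywhere G)" "ends (add_loop_everywhere G) x = {v}" for x v
      using m that unfolding infinitesimal_motion_def by blast
    have "motion V E l p q m"
      unfolding motion_def
    proof (intro conjI allI ballI impI)
      fix u v assume "{u, v} \<in> E"
      then obtain e where "e \<in> edges H" "ends H e = {u, v}" by (auto simp: E_def)
      then show "(p u - p v) \<bullet> (m u - m v) = 0" using edge[of e u v] subH by auto
    next
      fix v i assume v: "v \<in> V" and i: "i \<le> l v"
      show "q v i \<bullet> m v = 0"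
      proof (cases "i = 0")
        case True
        then show ?thesis using loop[of "Inr v" v] v subH by (simp add: Q_def add_loop_everywhere_def)
      next
        case False
        then have "i \<in> h v ` L v" using bij_betw_imp_surj_on[OF h[of v]] i by simp
        then obtain x where x: "i = h v x" "x \<in> loops H" "ends H x = {v}" by (auto simp: L_def)
        then have "ends G x = {v}" "x \<in> loops G" using subH by auto
        then show ?thesis using loop[of "Inl x" v] x by (simp add: Q_def add_loop_everywhere_def)
      qed
    qed
    then show "\<forall>v\<in>verts (add_loop_everywhere G). m v = 0"
      using rigid subH(3) by (simp add: rigid_def add_loop_everywhere_def)
  qed
  then show ?thesis by blast
qed

theorem theorem1p4:
  fixes G :: "('v, 'e) graph"
  assumes "is_graph G"
  shows "(\<exists>(p :: 'v \<Rightarrow> real ^ 3) (q :: 'e + 'v \<Rightarrow> real ^ 3).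
            infinitesimally_rigid (add_loop_everywhere G) p q) \<longleftrightarrow>
         (\<exists>H. spanning_subgraph H G \<and> looped_simple H \<and> tight_2_0 H \<and>
              \<not> contains_copy H (complete_graph 5))"
  using rigid_imp_tight_K5_free_subgraph[OF assms] tight_K5_free_subgraph_imp_rigid by blast

end
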